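(* Let $(X_i)_{i\in\mathbb{Z}}$ be a stationary reversible Markov chain. For real (measurable) functions $f_n$, $n\ge1$, define $X_{n,k}=f_n(X_k)$. Assume that $$\mathbb{E}X_{n,k}^4<\infty,\qquad \mathbb{E}X_{n,k}=0,\qquad \mathbb{E}(X_{n,0}^2)\to\sigma^2 \text{ as } n\to\infty,$$ $$\mathrm{cov}(X_{n,0},X_{n,2})+\sum_{k=2}^n\mathrm{cov}(X_{n,0},X_{n,k})\to0 \text{ as } n\to\infty,$$ and $$\frac1n\Big(\mathrm{var}(X_{n,0}^2)+\sum_{u=0}^n\mathrm{cov}(X_{n,0}^2,X_{n,u}^2)\Big)\to0 \text{ as } n\to\infty.$$ Then $$\frac{1}{\sqrt n}\sum_{k=1}^nX_{n,k}\Rightarrow N(0,\sigma^2)\quad\text{as } n\to\infty,$$ where $\Rightarrow$ denotes convergence in distribution.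
   Context: A stationary (strictly stationary) Markov chain $(X_i)_{i\in\mathbb{Z}}$ is reversible if $(X_0,X_1)$ and $(X_1,X_0)$ have the same distribution; equivalently, its transition operator $Q$, $(Qg)(x)=\mathbb{E}(g(X_1)\mid X_0=x)$, is self-adjoint on $\mathbb{L}_2(\pi)$, where $\pi$ is the marginal distribution of $X_0$. The chain is real-valued (Borel state space). *)

theory Defs
  imports "HOL-Probability.Probability"
begin

definition covariance :: "'a measure \<Rightarrow> ('a \<Rightarrow> real) \<Rightarrow> ('a \<Rightarrow> real) \<Rightarrow> real" where
  "covariance M Y Z =
     integral\<^sup>L M (\<lambda>\<omega>. (Y \<omega> - integral\<^sup>L M Y) * (Z \<omega> - integral\<^sup>L M Z))"

definition strictly_stationary :: "'a measure \<Rightarrow> (int \<Rightarrow> 'a \<Rightarrow> real) \<Rightarrow> bool" where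
  "strictly_stationary M X \<longleftrightarrow>
     (\<forall>h. distr M (PiM UNIV (\<lambda>_. borel)) (\<lambda>\<omega> i. X (i + h) \<omega>) =
          distr M (PiM UNIV (\<lambda>_. borel)) (\<lambda>\<omega> i. X i \<omega>))"

(* The sigma-algebra generated by all X i with i in I. *)
definition generated_algebra ::
  "'a measure \<Rightarrow> (int \<Rightarrow> 'a \<Rightarrow> real) \<Rightarrow> int set \<Rightarrow> 'a measure" where
  "generated_algebra M X I =
     sigma (space M) (\<Union>i\<in>I. {X i -` A \<inter> space M | A. A \<in> sets borel})"

(* P(X (n+1) in A | X i, i <= n) = P(X (n+1) in A | X n) almost surely; the chain is not
   required here to be time homogeneous. *)
definition markov_chain :: "'a measure \<Rightarrow> (int \<Rightarrow> 'a \<Rightarrow> real) \<Rightarrow> bool" where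
  "markov_chain M X \<longleftrightarrow>
     (\<forall>i. X i \<in> borel_measurable M) \<and>
     (\<forall>n. \<forall>A\<in>sets borel. AE \<omega> in M.
        real_cond_exp M (generated_algebra M X {..n}) (\<lambda>\<omega>. indicator A (X (n + 1) \<omega>)) \<omega> =
        real_cond_exp M (generated_algebra M X {n}) (\<lambda>\<omega>. indicator A (X (n + 1) \<omega>)) \<omega>)"

(* For a stationary chain, comparing times 0 and 1 suffices. *)
definition reversible :: "'a measure \<Rightarrow> (int \<Rightarrow> 'a \<Rightarrow> real) \<Rightarrow> bool" where
  "reversible M X \<longleftrightarrow>
     distr M (borel \<Otimes>\<^sub>M borel) (\<lambda>\<omega>. (X 0 \<omega>, X 1 \<omega>)) =
     distr M (borel \<Otimes>\<^sub>M borel) (\<lambda>\<omega>. (X 1 \<omega>, X 0 \<omega>))"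

(* Parametrized by mean and variance (normal_density takes the standard deviation);
   variance 0 gives the point mass at the mean. *)
definition normal_law :: "real \<Rightarrow> real \<Rightarrow> real measure" where
  "normal_law m v =
     (if v = 0 then return borel m else density lborel (normal_density m (sqrt v)))"

end

(* Let Q be the transition operator and write S_n = M_n + R_n with the martingale differences
   f_n(X_k) - (Q f_n)(X_(k-1)) and the remainder R_n = sum of (Q f_n)(X_(k-1)). By reversibility
   the autocovariances satisfy c_(k+2)(g) = c_k(Q g), so those of even order are nonnegative and
   decreasing and dominate their odd successors; hence any two partial sums are ordered up to
   one term c_0. This bounds var(R_n) / n by the first covariance hypothesis, and the variance
   of the normalized quadratic variation, and E f_n^4 / n, by the second one. The martingale is
   then treated by a quantitative martingale central limit theorem for characteristic functions,
   under a Lyapunov condition, and the theorem follows from Levy's continuity theorem. *)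

theory Submission
  imports Defs
begin

section \<open>Moment inequalities\<close>

text \<open>The functions \<open>f n\<close> change with n, so limit theorems for one fixed
  stationary sequence do not apply; every estimate is explicit at fixed n, and the limit is taken
  only at the end. The lag 2 covariance is the squared norm of \<open>Q g\<close>, so the first
  covariance hypothesis also makes the martingale increments close to g in L2. Odd lags may be
  negative, so partial sums of autocovariances need not increase with their length. This is the
  origin of the single terms placed in front of the two sums in the hypotheses: the lag 2 covariance
  and the variance of the square are the lag 0 autocovariances of \<open>Q g\<close> and of the
  centred square, precisely the slack lost when partial sums of different lengths are compared. The
  chain is given as a process and not by a kernel, so \<open>Q\<close> has to be extracted from
  conditional expectations. The hypotheses speak of squares rather than of conditional variances,
  and the martingale theorem is accordingly stated for the sum of squared increments.\<close>

lemma integrable_mult_of_squares: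
  fixes f g :: "'a \<Rightarrow> real"
  assumes [measurable]: "f \<in> borel_measurable M" "g \<in> borel_measurable M"
    and f2: "integrable M (\<lambda>x. (f x)\<^sup>2)" and g2: "integrable M (\<lambda>x. (g x)\<^sup>2)"
  shows "integrable M (\<lambda>x. f x * g x)"
proof (rule Bochner_Integration.integrable_bound[OF Bochner_Integration.integrable_add[OF f2 g2]])
  have "\<bar>a * b\<bar> \<le> a\<^sup>2 + b\<^sup>2" for a b :: real
  proof -
    have "2 * \<bar>a * b\<bar> \<le> a\<^sup>2 + b\<^sup>2"
      using sum_squares_bound[of "\<bar>a\<bar>" "\<bar>b\<bar>"] by (simp add: abs_mult)
    then show ?thesis
      by (rule order_trans[rotated]) simp
  qed
  then show "AE x in M. norm (f x * g x) \<le> norm ((f x)\<^sup>2 + (g x)\<^sup>2)"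
    by simp
qed measurable

text \<open>Cauchy-Schwarz from the weighted inequality 2|uw| \<le> a u^2 + w^2 / a, whose
  right-hand side is then minimized over the weight a.\<close>

lemma integral_abs_mult_le_sqrt:
  fixes f g :: "'a \<Rightarrow> real"
  assumes [measurable]: "f \<in> borel_measurable M" "g \<in> borel_measurable M"
    and f2: "integrable M (\<lambda>x. (f x)\<^sup>2)" and g2: "integrable M (\<lambda>x. (g x)\<^sup>2)"
  shows "(\<integral>x. \<bar>f x * g x\<bar> \<partial>M) \<le> sqrt ((\<integral>x. (f x)\<^sup>2 \<partial>M) * (\<integral>x. (g x)\<^sup>2 \<partial>M))"
proof -
  define A where "A = (\<integral>x. (f x)\<^sup>2 \<partial>M)"
  define B where "B = (\<integral>x. (g x)\<^sup>2 \<partial>M)"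
  have AB: "A \<ge> 0" "B \<ge> 0"
    by (auto simp: A_def B_def)
  have fg: "integrable M (\<lambda>x. \<bar>f x * g x\<bar>)"
    by (intro integrable_abs integrable_mult_of_squares f2 g2) measurable
  have weighted: "2 * (\<integral>x. \<bar>f x * g x\<bar> \<partial>M) \<le> a * A + B / a" if a: "a > 0" for a
  proof -
    have "2 * \<bar>u * w\<bar> \<le> a * u\<^sup>2 + w\<^sup>2 / a" for u w :: real
    proof -
      have "0 \<le> (a * \<bar>u\<bar> - \<bar>w\<bar>)\<^sup>2 / a"
        using a by simp
      also have "\<dots> = a * u\<^sup>2 + w\<^sup>2 / a - 2 * \<bar>u * w\<bar>"
        using a by (simp add: power2_diff power_mult_distrib abs_mult field_simps power2_eq_square)
      finally show ?thesis
        by simp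
    qed
    then have "(\<integral>x. 2 * \<bar>f x * g x\<bar> \<partial>M) \<le> (\<integral>x. a * (f x)\<^sup>2 + (g x)\<^sup>2 / a \<partial>M)"
      using f2 g2 fg by (intro integral_mono) auto
    then show ?thesis
      using f2 g2 by (simp add: A_def B_def)
  qed
  have "(\<integral>x. \<bar>f x * g x\<bar> \<partial>M) \<le> sqrt ((A + e) * (B + e))" if e: "e > 0" for e
  proof -
    \<comment> \<open>The optimal weight for the perturbed second moments \<open>A + e\<close> and
      \<open>B + e\<close>. The perturbation keeps it defined and positive when \<open>A\<close> or
      \<open>B\<close> is 0, and e tends to 0 afterwards.\<close>
    define a where "a = sqrt (B + e) / sqrt (A + e)"
    have pos: "A + e > 0" "B + e > 0"
      using AB e by auto
    then have a: "a > 0"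
      by (simp add: a_def)
    have "a * (A + e) = sqrt (B + e) * ((A + e) / sqrt (A + e))"
      by (simp add: a_def)
    then have "a * (A + e) = sqrt ((A + e) * (B + e))"
      using pos by (simp add: real_div_sqrt real_sqrt_mult)
    moreover have "(B + e) / a = sqrt (A + e) * ((B + e) / sqrt (B + e))"
      by (simp add: a_def)
    then have "(B + e) / a = sqrt ((A + e) * (B + e))"
      using pos by (simp add: real_div_sqrt real_sqrt_mult)
    moreover have "a * A \<le> a * (A + e)" "B / a \<le> (B + e) / a"
      using a e by (auto intro!: divide_right_mono)
    ultimately show ?thesis
      using weighted[OF a] by linarith
  qed
  then have ev: "\<forall>\<^sub>F e in at_right 0. (\<integral>x. \<bar>f x * g x\<bar> \<partial>M) \<le> sqrt ((A + e) * (B + e))"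
    by (rule eventually_mono[OF eventually_at_right_less])
  have "((\<lambda>e. sqrt ((A + e) * (B + e))) \<longlongrightarrow> sqrt ((A + 0) * (B + 0))) (at_right 0)"
    by (intro tendsto_intros)
  then show ?thesis
    unfolding A_def[symmetric] B_def[symmetric]
    using tendsto_lowerbound[OF _ ev] by simp
qed

lemma exp_minus_Taylor:
  fixes y :: real
  assumes "y \<ge> 0"
  shows "\<bar>exp (- y) - (1 - y)\<bar> \<le> y\<^sup>2 / 2"
proof -
  \<comment> \<open>The product is 1 + y^4 / 4. Bounding its second factor by \<open>exp y\<close>
    and dividing turns the lower Taylor bound for \<open>exp y\<close> into an upper bound for
    \<open>exp (- y)\<close>; the other side is \<open>1 - y \<le> exp (- y)\<close>.\<close>
  have "1 \<le> (1 - y + y\<^sup>2 / 2) * (1 + y + y\<^sup>2 / 2)"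
    using zero_le_power2[of "y\<^sup>2"] by (simp add: algebra_simps power2_eq_square)
  also have "\<dots> \<le> (1 - y + y\<^sup>2 / 2) * exp y"
  proof (rule mult_left_mono)
    show "1 + y + y\<^sup>2 / 2 \<le> exp y"
      using exp_lower_Taylor_quadratic[OF assms] by simp
    have "0 \<le> (1 - y)\<^sup>2 + 1"
      by (simp add: add_nonneg_nonneg)
    then show "0 \<le> 1 - y + y\<^sup>2 / 2"
      by (simp add: power2_eq_square algebra_simps)
  qed
  finally have "exp (- y) \<le> 1 - y + y\<^sup>2 / 2"
    by (simp add: exp_minus field_simps)
  then show ?thesis
    using exp_ge_add_one_self[of "- y"] by simp
qed

text \<open>In the application \<open>Y\<close> is a complex exponential determined by the past,
  whereas \<open>real_cond_exp\<close> acts on real functions; the tower property is applied to real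
  and imaginary part separately.\<close>

lemma (in sigma_finite_subalgebra) complex_integral_cond_exp:
  fixes Y :: "'a \<Rightarrow> complex"
  assumes Y: "Y \<in> borel_measurable F" and B: "\<And>x. norm (Y x) \<le> B" and g: "integrable M g"
  shows "(\<integral>x. Y x * complex_of_real (real_cond_exp M F g x) \<partial>M)
    = (\<integral>x. Y x * complex_of_real (g x) \<partial>M)"
proof -
  have YM [measurable]: "Y \<in> borel_measurable M"
    by (rule measurable_from_subalg[OF subalg Y])
  have [measurable]: "g \<in> borel_measurable M"
    using g by simp
  have intY: "integrable M (\<lambda>x. Y x * complex_of_real (h x))" if "integrable M h" for h
  proof (rule Bochner_Integration.integrable_bound)
    show "integrable M (\<lambda>x. B * h x)"
      using that by simp
    show "AE x in M. norm (Y x * complex_of_real (h x)) \<le> norm (B * h x)"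
      using order_trans[OF B abs_ge_self]
      by (auto simp: norm_mult abs_mult intro!: AE_I2 mult_right_mono)
    show "(\<lambda>x. Y x * complex_of_real (h x)) \<in> borel_measurable M"
      using that by measurable
  qed
  have Re: "(\<lambda>x. Re (Y x)) \<in> borel_measurable F" and Im: "(\<lambda>x. Im (Y x)) \<in> borel_measurable F"
    using Y by measurable
  have ReI: "integrable M (\<lambda>x. Re (Y x) * g x)"
    using integrable_Re[OF intY[OF g]] by simp
  have ImI: "integrable M (\<lambda>x. Im (Y x) * g x)"
    using integrable_Im[OF intY[OF g]] by simp
  have c: "integrable M (real_cond_exp M F g)"
    by (rule real_cond_exp_int(1)[OF g])
  show ?thesis
  proof (rule complex_eqI)
    show "Re (\<integral>x. Y x * complex_of_real (real_cond_exp M F g x) \<partial>M)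
        = Re (\<integral>x. Y x * complex_of_real (g x) \<partial>M)"
      using real_cond_exp_intg(2)[OF ReI Re] by (simp flip: integral_Re[OF intY[OF g]] integral_Re[OF intY[OF c]])
    show "Im (\<integral>x. Y x * complex_of_real (real_cond_exp M F g x) \<partial>M)
        = Im (\<integral>x. Y x * complex_of_real (g x) \<partial>M)"
      using real_cond_exp_intg(2)[OF ImI Im] by (simp flip: integral_Im[OF intY[OF g]] integral_Im[OF intY[OF c]])
  qed
qed

lemma (in prob_space) subalgebra_sigma_finite:
  "subalgebra M F \<Longrightarrow> sigma_finite_subalgebra M F"
  by (intro finite_measure_subalgebra_is_sigma_finite finite_measure_subalgebra.intro
      finite_measure_subalgebra_axioms.intro finite_measure_axioms)

lemma (in prob_space) integrable_power_le:
  fixes d :: "'a \<Rightarrow> real"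
  assumes [measurable]: "d \<in> borel_measurable M" and d: "integrable M (\<lambda>x. d x ^ m)"
    and "even m" "k \<le> m"
  shows "integrable M (\<lambda>x. \<bar>d x\<bar> ^ k)"
proof (rule Bochner_Integration.integrable_bound)
  show "integrable M (\<lambda>x. 1 + d x ^ m)"
    using d by simp
  have "\<bar>u\<bar> ^ k \<le> 1 + u ^ m" for u :: real
  proof (cases "\<bar>u\<bar> \<le> 1")
    case True
    then show ?thesis
      using power_le_one[of "\<bar>u\<bar>" k] zero_le_even_power[OF \<open>even m\<close>, of u] by simp
  next
    case False
    then have "\<bar>u\<bar> ^ k \<le> \<bar>u\<bar> ^ m"
      using \<open>k \<le> m\<close> by (intro power_increasing) auto
    then show ?thesis
      using \<open>even m\<close> by (simp add: power_even_abs)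
  qed
  then show "AE x in M. norm (\<bar>d x\<bar> ^ k) \<le> norm (1 + d x ^ m)"
    by (auto intro: order_trans[OF _ abs_ge_self])
qed measurable

text \<open>Conditional Jensen for the convex function x^m, then integration. Since m is even the
  power is nonnegative, so Jensen's inequality also gives integrability by domination.\<close>

lemma (in prob_space) cond_exp_power_le:
  fixes d :: "'a \<Rightarrow> real"
  assumes F: "subalgebra M F" and [measurable]: "d \<in> borel_measurable M"
    and d: "integrable M (\<lambda>x. d x ^ m)" and m: "even m" "m \<ge> 1"
  shows "integrable M (\<lambda>x. real_cond_exp M F d x ^ m)"
    and "expectation (\<lambda>x. real_cond_exp M F d x ^ m) \<le> expectation (\<lambda>x. d x ^ m)"
proof -
  interpret F: sigma_finite_subalgebra M F
    by (rule subalgebra_sigma_finite[OF F])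
  have d1: "integrable M d"
    using integrable_power_le[OF _ d m(1), of 1] m by (simp add: integrable_abs_iff)
  have cv: "convex_on UNIV (\<lambda>x::real. x ^ m)"
    using m by (intro convex_power_even)
  have J: "AE x in M. real_cond_exp M F d x ^ m \<le> real_cond_exp M F (\<lambda>x. d x ^ m) x"
    using F.real_cond_exp_jensens_inequality(2)[OF d1, where I=UNIV and q="\<lambda>x. x ^ m"] d cv by simp
  have i: "integrable M (real_cond_exp M F (\<lambda>x. d x ^ m))"
    by (rule F.real_cond_exp_int(1)[OF d])
  show *: "integrable M (\<lambda>x. real_cond_exp M F d x ^ m)"
  proof (rule Bochner_Integration.integrable_bound[OF i])
    show "AE x in M. norm (real_cond_exp M F d x ^ m) \<le> norm (real_cond_exp M F (\<lambda>x. d x ^ m) x)"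
      using J
    proof eventually_elim
      case (elim x)
      then show ?case
        using zero_le_even_power[OF m(1), of "real_cond_exp M F d x"] by simp
    qed
  qed measurable
  show "expectation (\<lambda>x. real_cond_exp M F d x ^ m) \<le> expectation (\<lambda>x. d x ^ m)"
    using integral_mono_AE[OF * i J] F.real_cond_exp_int(2)[OF d] by simp
qed

lemma integrable_square_add:
  fixes f g :: "'a \<Rightarrow> real"
  assumes [measurable]: "f \<in> borel_measurable M" "g \<in> borel_measurable M"
    and f2: "integrable M (\<lambda>x. (f x)\<^sup>2)" and g2: "integrable M (\<lambda>x. (g x)\<^sup>2)"
  shows "integrable M (\<lambda>x. (f x + g x)\<^sup>2)"
  using integrable_mult_of_squares[OF assms] f2 g2 by (simp add: power2_sum mult.assoc)

lemma integrable_square_diff: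
  fixes f g :: "'a \<Rightarrow> real"
  assumes "f \<in> borel_measurable M" "g \<in> borel_measurable M"
    and "integrable M (\<lambda>x. (f x)\<^sup>2)" "integrable M (\<lambda>x. (g x)\<^sup>2)"
  shows "integrable M (\<lambda>x. (f x - g x)\<^sup>2)"
  using integrable_square_add[of f M "\<lambda>x. - g x"] assms by simp

lemma integrable_square_sum:
  fixes f :: "'i \<Rightarrow> 'a \<Rightarrow> real"
  assumes [measurable]: "\<And>i. f i \<in> borel_measurable M"
    and f2: "\<And>i. integrable M (\<lambda>x. (f i x)\<^sup>2)"
  shows "integrable M (\<lambda>x. (\<Sum>i\<in>I. f i x)\<^sup>2)"
proof (induction I rule: infinite_finite_induct)
  case (insert i I)
  have "integrable M (\<lambda>x. (f i x + (\<Sum>i\<in>I. f i x))\<^sup>2)"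
    by (intro integrable_square_add f2 insert) measurable
  then show ?case
    using insert by simp
qed simp_all

lemma (in prob_space) expectation_abs_le_sqrt:
  fixes f :: "'a \<Rightarrow> real"
  assumes "f \<in> borel_measurable M" "integrable M (\<lambda>x. (f x)\<^sup>2)"
  shows "expectation (\<lambda>x. \<bar>f x\<bar>) \<le> sqrt (expectation (\<lambda>x. (f x)\<^sup>2))"
  using integral_abs_mult_le_sqrt[of f M "\<lambda>_. 1"] assms by (simp add: prob_space)

lemma (in prob_space) integrable_of_square:
  fixes f :: "'a \<Rightarrow> real"
  assumes "f \<in> borel_measurable M" "integrable M (\<lambda>x. (f x)\<^sup>2)"
  shows "integrable M f"
  using integrable_power_le[OF assms, of 1] assms by (simp add: integrable_abs_iff)

lemma (in prob_space) integrable_square_of_power4: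
  fixes f :: "'a \<Rightarrow> real"
  assumes "f \<in> borel_measurable M" "integrable M (\<lambda>x. f x ^ 4)"
  shows "integrable M (\<lambda>x. (f x)\<^sup>2)"
  using integrable_power_le[OF assms, of 2] by simp

(* The maximum makes this version nonnegative everywhere and not just almost surely. *)
definition cond_square :: "'a measure \<Rightarrow> 'a measure \<Rightarrow> ('a \<Rightarrow> real) \<Rightarrow> 'a \<Rightarrow> real" where
  "cond_square M F d x = max 0 (real_cond_exp M F (\<lambda>x. (d x)\<^sup>2) x)"

lemma cond_square_nonneg: "cond_square M F d x \<ge> 0"
  by (simp add: cond_square_def)

lemma borel_measurable_cond_square: "cond_square M F d \<in> borel_measurable F"
  unfolding cond_square_def[abs_def] by measurable

lemma power4_eq_square_square: "(x::real) ^ 4 = (x\<^sup>2)\<^sup>2"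
  by simp

section \<open>Conditional second moments and the one-step estimate\<close>

context prob_space
begin

context
  fixes F and d :: "'a \<Rightarrow> real"
  assumes F: "subalgebra M F" and d [measurable]: "d \<in> borel_measurable M"
    and d4: "integrable M (\<lambda>x. d x ^ 4)"
begin

interpretation F: sigma_finite_subalgebra M F
  by (rule subalgebra_sigma_finite[OF F])

lemma AE_cond_square: "AE x in M. cond_square M F d x = real_cond_exp M F (\<lambda>x. (d x)\<^sup>2) x"
  using F.real_cond_exp_pos[of "\<lambda>x. (d x)\<^sup>2"] by (auto simp: cond_square_def)

lemma measurable_M_cond_square [measurable]: "cond_square M F d \<in> borel_measurable M"
  by (rule measurable_from_subalg[OF F borel_measurable_cond_square])

lemma integrable_cond_square: "integrable M (cond_square M F d)"
  by (rule Bochner_Integration.integrable_cong_AE[THEN iffD2, OF _ _ AE_cond_square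
        F.real_cond_exp_int(1)[OF integrable_square_of_power4[OF d d4]]]) measurable

lemma cond_square_square:
  shows "integrable M (\<lambda>x. (cond_square M F d x)\<^sup>2)"
    and "expectation (\<lambda>x. (cond_square M F d x)\<^sup>2) \<le> expectation (\<lambda>x. d x ^ 4)"
proof -
  have i: "integrable M (\<lambda>x. ((d x)\<^sup>2)\<^sup>2)"
    using d4 by simp
  have J: "integrable M (\<lambda>x. (real_cond_exp M F (\<lambda>x. (d x)\<^sup>2) x)\<^sup>2)"
      "expectation (\<lambda>x. (real_cond_exp M F (\<lambda>x. (d x)\<^sup>2) x)\<^sup>2) \<le> expectation (\<lambda>x. ((d x)\<^sup>2)\<^sup>2)"
    using cond_exp_power_le[OF F _ i] by auto
  have AE: "AE x in M. (cond_square M F d x)\<^sup>2 = (real_cond_exp M F (\<lambda>x. (d x)\<^sup>2) x)\<^sup>2"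
    using AE_cond_square by eventually_elim simp
  show "integrable M (\<lambda>x. (cond_square M F d x)\<^sup>2)"
    by (rule Bochner_Integration.integrable_cong_AE[THEN iffD2, OF _ _ AE J(1)]) measurable
  have "expectation (\<lambda>x. (cond_square M F d x)\<^sup>2)
      = expectation (\<lambda>x. (real_cond_exp M F (\<lambda>x. (d x)\<^sup>2) x)\<^sup>2)"
    by (rule integral_cong_AE[OF _ _ AE]) measurable
  then show "expectation (\<lambda>x. (cond_square M F d x)\<^sup>2) \<le> expectation (\<lambda>x. d x ^ 4)"
    using J(2) by simp
qed

lemma expectation_mult_cond_square:
  assumes h: "h \<in> borel_measurable F" and h2: "integrable M (\<lambda>x. (h x)\<^sup>2)"
  shows "expectation (\<lambda>x. h x * cond_square M F d x) = expectation (\<lambda>x. h x * (d x)\<^sup>2)"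
proof -
  have hM [measurable]: "h \<in> borel_measurable M"
    by (rule measurable_from_subalg[OF F h])
  have AE: "AE x in M. h x * cond_square M F d x = h x * real_cond_exp M F (\<lambda>x. (d x)\<^sup>2) x"
    using AE_cond_square by eventually_elim simp
  have "expectation (\<lambda>x. h x * cond_square M F d x)
      = expectation (\<lambda>x. h x * real_cond_exp M F (\<lambda>x. (d x)\<^sup>2) x)"
    by (rule integral_cong_AE[OF _ _ AE]) measurable
  also have "\<dots> = expectation (\<lambda>x. h x * (d x)\<^sup>2)"
    using h d4 by (intro F.real_cond_exp_intg(2) integrable_mult_of_squares h2) auto
  finally show ?thesis .
qed

text \<open>Both exponentials are expanded around 0. Against the weight \<open>Y\<close>, known
  given \<open>F\<close>, the linear term integrates to 0 by \<open>zero\<close>, and the square of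
  d has the same integral as \<open>cond_square M F d\<close>, so only remainders survive: 1/6 is
  the cubic remainder of \<open>iexp\<close>, and 1/8 is half the square of the 1/2 in the exponent,
  by \<open>exp_minus_Taylor\<close>. The squared conditional moment is then bounded by E
  d^4.\<close>

lemma martingale_step:
  fixes Y :: "'a \<Rightarrow> complex"
  assumes zero: "AE x in M. real_cond_exp M F d x = 0"
    and Y: "Y \<in> borel_measurable F" and B: "\<And>x. norm (Y x) \<le> B"
  shows "norm (CLINT x|M. Y x * (iexp (t * d x) - complex_of_real (exp (- (t\<^sup>2 * cond_square M F d x / 2)))))
    \<le> B * (\<bar>t\<bar> ^ 3 / 6 * expectation (\<lambda>x. \<bar>d x\<bar> ^ 3) + t ^ 4 / 8 * expectation (\<lambda>x. d x ^ 4))"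
proof -
  let ?v = "cond_square M F d"
  have YM [measurable]: "Y \<in> borel_measurable M"
    by (rule measurable_from_subalg[OF F Y])
  have B0: "B \<ge> 0"
    using order_trans[OF norm_ge_zero B] by blast
  have d1: "integrable M d"
    by (rule integrable_of_square[OF d integrable_square_of_power4[OF d d4]])
  have d2: "integrable M (\<lambda>x. (d x)\<^sup>2)"
    by (rule integrable_square_of_power4[OF d d4])
  have d3: "integrable M (\<lambda>x. \<bar>d x\<bar> ^ 3)"
    by (rule integrable_power_le[OF d d4]) auto
  have intY: "integrable M (\<lambda>x. Y x * h x)"
    if "integrable M h" for h :: "'a \<Rightarrow> complex"
  proof (rule Bochner_Integration.integrable_bound)
    show "integrable M (\<lambda>x. complex_of_real B * h x)"
      using that by simp
    show "AE x in M. norm (Y x * h x) \<le> norm (complex_of_real B * h x)"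
      using B B0 by (auto simp: norm_mult intro!: AE_I2 mult_right_mono)
    show "(\<lambda>x. Y x * h x) \<in> borel_measurable M"
      using that by measurable
  qed
  have of1: "integrable M (\<lambda>x. complex_of_real (d x))"
    and of2: "integrable M (\<lambda>x. complex_of_real ((d x)\<^sup>2))"
    and ofv: "integrable M (\<lambda>x. complex_of_real (?v x))"
    using d1 d2 integrable_cond_square by (simp_all only: integrable_of_real)
  have Yd: "(CLINT x|M. Y x * complex_of_real (d x)) = 0"
  proof -
    have "(CLINT x|M. Y x * complex_of_real (d x))
        = (CLINT x|M. Y x * complex_of_real (real_cond_exp M F d x))"
      by (rule F.complex_integral_cond_exp[OF Y B d1, symmetric])
    also have "\<dots> = (CLINT x|M. 0)"
      using zero by (intro integral_cong_AE) auto
    finally show ?thesis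
      by simp
  qed
  have Yv: "(CLINT x|M. Y x * complex_of_real (?v x)) = (CLINT x|M. Y x * complex_of_real ((d x)\<^sup>2))"
  proof -
    have "AE x in M. Y x * complex_of_real (?v x)
        = Y x * complex_of_real (real_cond_exp M F (\<lambda>x. (d x)\<^sup>2) x)"
      using AE_cond_square by eventually_elim simp
    then have "(CLINT x|M. Y x * complex_of_real (?v x))
        = (CLINT x|M. Y x * complex_of_real (real_cond_exp M F (\<lambda>x. (d x)\<^sup>2) x))"
      by (intro integral_cong_AE) measurable
    also have "\<dots> = (CLINT x|M. Y x * complex_of_real ((d x)\<^sup>2))"
      by (rule F.complex_integral_cond_exp[OF Y B d2])
    finally show ?thesis .
  qed
  \<comment> \<open>What remains after removing the terms whose integrals against \<open>Y\<close>
    vanish or cancel by \<open>Yd\<close> and \<open>Yv\<close>.\<close>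
  define R where "R x = iexp (t * d x) - complex_of_real (exp (- (t\<^sup>2 * ?v x / 2)))
      - (\<i> * t * d x - (t\<^sup>2 / 2) * (d x)\<^sup>2 + (t\<^sup>2 / 2) * ?v x)" for x
  have R_meas [measurable]: "R \<in> borel_measurable M"
    unfolding R_def[abs_def] by measurable
  let ?b = "\<lambda>x. \<bar>t\<bar> ^ 3 / 6 * \<bar>d x\<bar> ^ 3 + t ^ 4 / 8 * (?v x)\<^sup>2"
  have R_le: "norm (R x) \<le> ?b x" for x
  proof -
    have 1: "norm (iexp (t * d x) - (1 + \<i> * t * d x - (t\<^sup>2 / 2) * (d x)\<^sup>2)) \<le> \<bar>t\<bar> ^ 3 / 6 * \<bar>d x\<bar> ^ 3"
      using iexp_approx1[of "t * d x" 2]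
      by (simp add: numeral_2_eq_2 numeral_3_eq_3 abs_mult power_mult_distrib algebra_simps)
    have y: "0 \<le> t\<^sup>2 * ?v x / 2"
      using cond_square_nonneg by (auto intro!: mult_nonneg_nonneg)
    have 2: "norm (complex_of_real (exp (- (t\<^sup>2 * ?v x / 2)) - (1 - t\<^sup>2 * ?v x / 2))) \<le> t ^ 4 / 8 * (?v x)\<^sup>2"
      using exp_minus_Taylor[OF y] unfolding norm_of_real by (simp add: power_mult_distrib power_divide)
    have "R x = (iexp (t * d x) - (1 + \<i> * t * d x - (t\<^sup>2 / 2) * (d x)\<^sup>2))
        - complex_of_real (exp (- (t\<^sup>2 * ?v x / 2)) - (1 - t\<^sup>2 * ?v x / 2))"
      by (simp add: R_def)
    then show ?thesis
      by (simp only:) (rule order_trans[OF norm_triangle_ineq4 add_mono[OF 1 2]])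
  qed
  have b_int: "integrable M ?b"
    using d3 cond_square_square(1) by simp
  have R_int: "integrable M R"
    by (rule Bochner_Integration.integrable_bound[OF b_int])
      (use R_le order_trans[OF _ abs_ge_self] in auto)
  have "(CLINT x|M. Y x * (iexp (t * d x) - complex_of_real (exp (- (t\<^sup>2 * ?v x / 2)))))
      = (CLINT x|M. (\<i> * t) * (Y x * complex_of_real (d x))
          - (t\<^sup>2 / 2) * (Y x * complex_of_real ((d x)\<^sup>2))
          + (t\<^sup>2 / 2) * (Y x * complex_of_real (?v x)) + Y x * R x)"
    by (intro Bochner_Integration.integral_cong refl) (simp add: R_def algebra_simps)
  also have "\<dots> = (\<i> * t) * (CLINT x|M. Y x * complex_of_real (d x))
          - (t\<^sup>2 / 2) * (CLINT x|M. Y x * complex_of_real ((d x)\<^sup>2))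
          + (t\<^sup>2 / 2) * (CLINT x|M. Y x * complex_of_real (?v x)) + (CLINT x|M. Y x * R x)"
    using intY[OF of1] intY[OF of2] intY[OF ofv] intY[OF R_int]
    by (simp only: Bochner_Integration.integral_add Bochner_Integration.integral_diff
        integral_mult_right_zero Bochner_Integration.integrable_add
        Bochner_Integration.integrable_diff integrable_mult_right)
  also have "\<dots> = (CLINT x|M. Y x * R x)"
    unfolding Yd Yv by simp
  finally have "norm (CLINT x|M. Y x * (iexp (t * d x) - complex_of_real (exp (- (t\<^sup>2 * ?v x / 2)))))
      = norm (CLINT x|M. Y x * R x)"
    by simp
  also have "\<dots> \<le> (\<integral>x. norm (Y x * R x) \<partial>M)"
    by (rule integral_norm_bound)
  also have "\<dots> \<le> (\<integral>x. B * ?b x \<partial>M)"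
    using B R_le B0 b_int intY[OF R_int]
    by (intro integral_mono integrable_norm) (auto simp: norm_mult intro!: mult_mono)
  also have "\<dots> = B * (\<bar>t\<bar> ^ 3 / 6 * expectation (\<lambda>x. \<bar>d x\<bar> ^ 3) + t ^ 4 / 8 * expectation (\<lambda>x. (?v x)\<^sup>2))"
    using d3 cond_square_square(1) by simp
  also have "\<dots> \<le> B * (\<bar>t\<bar> ^ 3 / 6 * expectation (\<lambda>x. \<bar>d x\<bar> ^ 3) + t ^ 4 / 8 * expectation (\<lambda>x. d x ^ 4))"
    using cond_square_square(2) B0 by (intro mult_left_mono add_left_mono) auto
  finally show ?thesis .
qed

end

end

section \<open>Martingale central limit theorem\<close>

lemma abs_exp_diff_le:
  fixes x y b :: real
  assumes "x \<le> b" "y \<le> b"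
  shows "\<bar>exp x - exp y\<bar> \<le> exp b * \<bar>x - y\<bar>"
proof -
  have *: "exp v - exp u \<le> exp b * (v - u)" if "u \<le> v" "v \<le> b" for u v :: real
  proof -
    have "exp v - exp u = exp v * (1 - exp (u - v))"
      by (simp add: right_diff_distrib exp_diff)
    also have "\<dots> \<le> exp v * (v - u)"
    proof (rule mult_left_mono)
      show "1 - exp (u - v) \<le> v - u"
        using exp_ge_add_one_self[of "u - v"] by linarith
    qed simp
    also have "\<dots> \<le> exp b * (v - u)"
      using that by (intro mult_right_mono) auto
    finally show ?thesis .
  qed
  show ?thesis
    using *[of x y] *[of y x] assms by (cases "x \<le> y") (auto simp: abs_if)
qed

context prob_space
begin

context
  fixes F :: "nat \<Rightarrow> 'a measure" and D :: "nat \<Rightarrow> 'a \<Rightarrow> real"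
  assumes sub: "\<And>k. subalgebra M (F k)"
    and mono: "\<And>k. sets (F k) \<subseteq> sets (F (Suc k))"
    and adapted: "\<And>k. D k \<in> borel_measurable (F (Suc k))"
    and D4: "\<And>k. integrable M (\<lambda>x. D k x ^ 4)"
begin

lemma sets_filtration_mono: "i \<le> j \<Longrightarrow> sets (F i) \<subseteq> sets (F j)"
  by (rule lift_Suc_mono_le[of "\<lambda>k. sets (F k)", OF mono])

lemma measurable_filtration_mono:
  assumes "i \<le> j" "h \<in> borel_measurable (F i)"
  shows "h \<in> borel_measurable (F j)"
proof -
  have "space (F i) = space (F j)"
    using sub[of i] sub[of j] by (simp add: subalgebra_def)
  then show ?thesis
    using assms sets_filtration_mono[OF assms(1)] by (auto simp: measurable_def)
qed

lemma measurable_adapted: "i < k \<Longrightarrow> D i \<in> borel_measurable (F k)"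
  by (rule measurable_filtration_mono[of "Suc i"]) (auto intro: adapted)

lemma measurable_M_adapted: "D i \<in> borel_measurable M"
  by (rule measurable_from_subalg[OF sub adapted])

text \<open>\<open>D k\<close> is the increment from time k to k + 1, so its conditional second
  moment is already known at time k; the stopping rule of \<open>martingale_char_bound\<close> rests
  on this.\<close>

lemma measurable_predictable: "i \<le> k \<Longrightarrow> cond_square M (F i) (D i) \<in> borel_measurable (F k)"
  by (rule measurable_filtration_mono[of i]) (auto intro: borel_measurable_cond_square)

text \<open>The compensated squares are themselves martingale differences, hence orthogonal, and
  each has second moment E D^4 - E v^2, where v is the conditional second moment.\<close>

lemma expectation_square_compensated:
  "expectation (\<lambda>x. (\<Sum>k<n. (D k x)\<^sup>2 - cond_square M (F k) (D k) x)\<^sup>2)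
    \<le> (\<Sum>k<n. expectation (\<lambda>x. D k x ^ 4))"
proof (induction n)
  case 0
  show ?case by simp
next
  case (Suc n)
  note [measurable] = measurable_M_adapted measurable_M_cond_square[OF sub measurable_M_adapted D4]
  let ?v = "\<lambda>k. cond_square M (F k) (D k)"
  let ?u = "\<lambda>k x. (D k x)\<^sup>2 - ?v k x"
  let ?S = "\<lambda>x. \<Sum>k<n. ?u k x"
  have v2: "integrable M (\<lambda>x. (?v k x)\<^sup>2)" for k
    by (rule cond_square_square(1)[OF sub measurable_M_adapted D4])
  have DD: "integrable M (\<lambda>x. ((D k x)\<^sup>2)\<^sup>2)" for k
    using D4[of k] by simp
  have u2: "integrable M (\<lambda>x. (?u k x)\<^sup>2)" for k
    by (intro integrable_square_diff DD v2) measurable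
  have S2: "integrable M (\<lambda>x. (?S x)\<^sup>2)"
    by (intro integrable_square_sum u2) measurable
  have S_F: "?S \<in> borel_measurable (F n)"
    using measurable_adapted[of _ n] measurable_predictable[of _ n]
    by (intro borel_measurable_sum borel_measurable_diff borel_measurable_power) auto
  have SD: "integrable M (\<lambda>x. ?S x * (D n x)\<^sup>2)" and Sv: "integrable M (\<lambda>x. ?S x * ?v n x)"
    by (intro integrable_mult_of_squares S2 v2 DD; measurable)+
  \<comment> \<open>Orthogonality: \<open>?S\<close> is known at time n, so under the integral the
    new square may be replaced by its conditional version.\<close>
  have Su: "expectation (\<lambda>x. ?S x * ?u n x) = 0"
  proof -
    have "expectation (\<lambda>x. ?S x * ?u n x) = expectation (\<lambda>x. ?S x * (D n x)\<^sup>2 - ?S x * ?v n x)"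
      by (simp only: right_diff_distrib)
    also have "\<dots> = expectation (\<lambda>x. ?S x * (D n x)\<^sup>2) - expectation (\<lambda>x. ?S x * ?v n x)"
      by (rule Bochner_Integration.integral_diff[OF SD Sv])
    also have "\<dots> = 0"
      using expectation_mult_cond_square[OF sub measurable_M_adapted D4 S_F S2] by simp
    finally show ?thesis .
  qed
  have vD: "integrable M (\<lambda>x. ?v n x * (D n x)\<^sup>2)"
    by (intro integrable_mult_of_squares v2 DD) measurable
  have u_le: "expectation (\<lambda>x. (?u n x)\<^sup>2) \<le> expectation (\<lambda>x. D n x ^ 4)"
  proof -
    have "expectation (\<lambda>x. (?u n x)\<^sup>2)
        = expectation (\<lambda>x. D n x ^ 4 + (?v n x)\<^sup>2 - 2 * (?v n x * (D n x)\<^sup>2))"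
      by (intro Bochner_Integration.integral_cong refl) (simp add: power2_diff)
    also have "\<dots> = expectation (\<lambda>x. D n x ^ 4) + expectation (\<lambda>x. (?v n x)\<^sup>2)
        - 2 * expectation (\<lambda>x. ?v n x * (D n x)\<^sup>2)"
      using D4[of n] v2[of n] vD by simp
    finally have "expectation (\<lambda>x. (?u n x)\<^sup>2)
        = expectation (\<lambda>x. D n x ^ 4) + expectation (\<lambda>x. (?v n x)\<^sup>2)
        - 2 * expectation (\<lambda>x. ?v n x * (D n x)\<^sup>2)" .
    \<comment> \<open>The tower property with \<open>?v n\<close> itself as the factor known at time
      n.\<close>
    moreover have "expectation (\<lambda>x. ?v n x * (D n x)\<^sup>2) = expectation (\<lambda>x. (?v n x)\<^sup>2)"
      using expectation_mult_cond_square[OF sub measurable_M_adapted D4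
          borel_measurable_cond_square v2, of n] by (simp add: power2_eq_square)
    moreover have "0 \<le> expectation (\<lambda>x. (?v n x)\<^sup>2)"
      by simp
    ultimately show ?thesis
      by linarith
  qed
  have Su_int: "integrable M (\<lambda>x. ?S x * ?u n x)"
    by (intro integrable_mult_of_squares S2 u2) measurable
  have "expectation (\<lambda>x. (\<Sum>k<Suc n. ?u k x)\<^sup>2)
      = expectation (\<lambda>x. (?S x)\<^sup>2 + 2 * (?S x * ?u n x) + (?u n x)\<^sup>2)"
    unfolding sum.lessThan_Suc power2_sum
    by (intro Bochner_Integration.integral_cong refl) (simp add: mult.assoc)
  also have "\<dots> = expectation (\<lambda>x. (?S x)\<^sup>2) + 2 * expectation (\<lambda>x. ?S x * ?u n x)
      + expectation (\<lambda>x. (?u n x)\<^sup>2)"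
    using S2 Su_int u2[of n]
    by (simp only: Bochner_Integration.integral_add integral_mult_right_zero
        Bochner_Integration.integrable_add integrable_mult_right)
  finally show ?case
    using Suc Su u_le by simp
qed

text \<open>Trades conditional variances for actual squares, whose average can be computed from
  stationarity; the price is the square root of a Lyapunov sum.\<close>

lemma expectation_cond_square_deviation:
  shows "expectation (\<lambda>x. \<bar>(\<Sum>k<n. cond_square M (F k) (D k) x) - s\<bar>)
    \<le> expectation (\<lambda>x. \<bar>(\<Sum>k<n. (D k x)\<^sup>2) - s\<bar>) + sqrt (\<Sum>k<n. expectation (\<lambda>x. D k x ^ 4))"
proof -
  note [measurable] = measurable_M_adapted measurable_M_cond_square[OF sub measurable_M_adapted D4]
  let ?v = "\<lambda>k. cond_square M (F k) (D k)"
  let ?S = "\<lambda>x. \<Sum>k<n. (D k x)\<^sup>2 - ?v k x"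
  have v2: "integrable M (\<lambda>x. (?v k x)\<^sup>2)" for k
    by (rule cond_square_square(1)[OF sub measurable_M_adapted D4])
  have v1: "integrable M (?v k)" for k
    by (rule integrable_cond_square[OF sub measurable_M_adapted D4])
  have D2: "integrable M (\<lambda>x. (D k x)\<^sup>2)" for k
    by (rule integrable_square_of_power4[OF measurable_M_adapted D4])
  have DD: "integrable M (\<lambda>x. ((D k x)\<^sup>2)\<^sup>2)" for k
    using D4[of k] by simp
  have S2: "integrable M (\<lambda>x. (?S x)\<^sup>2)"
    by (intro integrable_square_sum integrable_square_diff v2 DD) measurable
  have S1: "integrable M ?S"
    by (intro Bochner_Integration.integrable_sum Bochner_Integration.integrable_diff v1 D2)
  have i: "integrable M (\<lambda>x. \<bar>(\<Sum>k<n. ?v k x) - s\<bar>)" "integrable M (\<lambda>x. \<bar>(\<Sum>k<n. (D k x)\<^sup>2) - s\<bar>)"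
    by (intro integrable_abs Bochner_Integration.integrable_sum Bochner_Integration.integrable_diff v1 D2
        integrable_const)+
  have "expectation (\<lambda>x. \<bar>(\<Sum>k<n. ?v k x) - s\<bar>)
      \<le> expectation (\<lambda>x. \<bar>(\<Sum>k<n. (D k x)\<^sup>2) - s\<bar> + \<bar>?S x\<bar>)"
    using i S1 by (intro integral_mono) (auto simp: sum_subtractf)
  also have "\<dots> = expectation (\<lambda>x. \<bar>(\<Sum>k<n. (D k x)\<^sup>2) - s\<bar>) + expectation (\<lambda>x. \<bar>?S x\<bar>)"
    by (rule Bochner_Integration.integral_add[OF i(2) integrable_abs[OF S1]])
  also have "expectation (\<lambda>x. \<bar>?S x\<bar>) \<le> sqrt (expectation (\<lambda>x. (?S x)\<^sup>2))"
    by (intro expectation_abs_le_sqrt S2) measurable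
  also have "\<dots> \<le> sqrt (\<Sum>k<n. expectation (\<lambda>x. D k x ^ 4))"
    by (intro real_sqrt_le_mono expectation_square_compensated)
  finally show ?thesis
    by simp
qed

(* The martingale is stopped just before its conditional quadratic variation exceeds s + 1,
   which is a predictable event; the compensated exponential Z is then bounded and its
   expectation is 1 up to the one-step Taylor errors. *)
lemma martingale_char_bound:
  fixes s t :: real
  assumes zero: "\<And>k. AE x in M. real_cond_exp M (F k) (D k) x = 0"
    and s: "s \<ge> 0"
  defines "a \<equiv> exp (t\<^sup>2 * (s + 1) / 2)"
  shows "norm ((CLINT x|M. iexp (t * (\<Sum>k<n. D k x))) - complex_of_real (exp (- (t\<^sup>2 * s / 2))))
    \<le> (1 + a + a * t\<^sup>2 / 2) * (expectation (\<lambda>x. \<bar>(\<Sum>k<n. (D k x)\<^sup>2) - s\<bar>)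
        + sqrt (\<Sum>k<n. expectation (\<lambda>x. D k x ^ 4)))
      + a * (\<bar>t\<bar> ^ 3 / 6 * (\<Sum>k<n. expectation (\<lambda>x. \<bar>D k x\<bar> ^ 3))
        + t ^ 4 / 8 * (\<Sum>k<n. expectation (\<lambda>x. D k x ^ 4)))"
proof -
  define v where "v k = cond_square M (F k) (D k)" for k
  define V where "V k x = (\<Sum>j<k. v j x)" for k x
  \<comment> \<open>\<open>V (Suc k)\<close> already contains \<open>v k\<close> and is still
    \<open>F k\<close>-measurable, so the decision to admit increment k takes its conditional
    variance into account and remains predictable.\<close>
  define \<theta> where "\<theta> k x = (if V (Suc k) x \<le> s + 1 then 1 else 0 :: real)" for k x
  define W where "W k x = (\<Sum>j<k. \<theta> j x * D j x)" for k x
  define V' where "V' k x = (\<Sum>j<k. \<theta> j x * v j x)" for k x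
  define Z where "Z k x = iexp (t * W k x) * complex_of_real (exp (t\<^sup>2 * V' k x / 2))" for k x
  \<comment> \<open>Taking \<open>V' (Suc k)\<close> instead of \<open>V' k\<close> keeps
    \<open>Y k\<close> known at time k and absorbs the compensator of the next increment, so that
    the change of \<open>Z\<close> has the form treated by \<open>martingale_step\<close>.\<close>
  define Y where "Y k x = iexp (t * W k x) * complex_of_real (exp (t\<^sup>2 * V' (Suc k) x / 2)) * complex_of_real (\<theta> k x)" for k x
  have v_nonneg: "v k x \<ge> 0" for k x
    by (simp add: v_def cond_square_nonneg)
  have v_meas: "v j \<in> borel_measurable (F k)" if "j \<le> k" for j k
    unfolding v_def by (rule measurable_predictable[OF that])
  have V_meas: "V (Suc j) \<in> borel_measurable (F k)" if "j \<le> k" for j k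
    unfolding V_def[abs_def] using that by (intro borel_measurable_sum v_meas) auto
  have \<theta>_meas: "\<theta> j \<in> borel_measurable (F k)" if "j \<le> k" for j k
    using V_meas[OF that] unfolding \<theta>_def[abs_def] by measurable
  have W_meas: "W k \<in> borel_measurable (F k)" for k
    unfolding W_def[abs_def] by (intro borel_measurable_sum borel_measurable_times \<theta>_meas measurable_adapted) auto
  have V'_meas: "V' (Suc k) \<in> borel_measurable (F k)" for k
    unfolding V'_def[abs_def] by (intro borel_measurable_sum borel_measurable_times \<theta>_meas v_meas) auto
  have Y_meas: "Y k \<in> borel_measurable (F k)" for k
    using W_meas[of k] V'_meas[of k] \<theta>_meas[of k k] unfolding Y_def[abs_def] by measurable
  have [measurable]: "v k \<in> borel_measurable M" "\<theta> k \<in> borel_measurable M" "D k \<in> borel_measurable M" for k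
    by (auto intro: measurable_from_subalg[OF sub] v_meas \<theta>_meas measurable_M_adapted)
  have [measurable]: "W k \<in> borel_measurable M" "V' k \<in> borel_measurable M" "V k \<in> borel_measurable M" for k
    unfolding W_def[abs_def] V'_def[abs_def] V_def[abs_def] by measurable
  have [measurable]: "Z k \<in> borel_measurable M" "Y k \<in> borel_measurable M" for k
    unfolding Z_def[abs_def] Y_def[abs_def] by measurable
  have V_mono: "V j x \<le> V k x" if "j \<le> k" for j k x
    unfolding V_def using that by (intro sum_mono2) (auto simp: v_nonneg)
  have V'_le_V: "V' k x \<le> V k x" for k x
    unfolding V'_def V_def by (intro sum_mono) (auto simp: \<theta>_def v_nonneg)
  have V'_le: "V' k x \<le> s + 1" for k x
  proof (induction k)
    case 0
    then show ?case using s by (simp add: V'_def)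
  next
    case (Suc k)
    show ?case
    proof (cases "V (Suc k) x \<le> s + 1")
      case True
      then show ?thesis using V'_le_V[of "Suc k" x] by simp
    next
      case False
      then show ?thesis using Suc by (simp add: V'_def \<theta>_def)
    qed
  qed
  have V'_exp: "exp (t\<^sup>2 * V' k x / 2) \<le> a" for k x
    unfolding a_def using V'_le[of k x] by (simp add: mult_left_mono)
  have a1: "a > 0"
    by (simp add: a_def)
  have Z_le: "norm (Z k x) \<le> a" for k x
    using V'_exp[of k x] by (simp add: Z_def norm_mult)
  have Y_le: "norm (Y k x) \<le> a" for k x
    using V'_exp[of "Suc k" x] a1 by (simp add: Y_def norm_mult \<theta>_def)
  have Z_int: "integrable M (Z k)" for k
    by (rule integrable_const_bound[of _ a]) (auto simp: Z_le)
  have step: "Z (Suc k) x - Z k x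
      = Y k x * (iexp (t * D k x) - complex_of_real (exp (- (t\<^sup>2 * v k x / 2))))" for k x
  proof (cases "V (Suc k) x \<le> s + 1")
    case True
    have W: "W (Suc k) x = W k x + D k x" and V': "V' (Suc k) x = V' k x + v k x"
      using True by (simp_all add: W_def V'_def \<theta>_def)
    have 1: "iexp (t * (W k x + D k x)) = iexp (t * W k x) * iexp (t * D k x)"
      by (simp add: exp_add[symmetric] algebra_simps)
    have 2: "exp (t\<^sup>2 * V' k x / 2) = exp (t\<^sup>2 * (V' k x + v k x) / 2) * exp (- (t\<^sup>2 * v k x / 2))"
      by (simp add: exp_add[symmetric] algebra_simps add_divide_distrib)
    show ?thesis
      unfolding Z_def Y_def W V' 1
      using True by (subst 2) (simp add: \<theta>_def algebra_simps)
  next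
    case False
    then show ?thesis
      by (simp add: Z_def Y_def \<theta>_def W_def V'_def)
  qed
  let ?e = "\<lambda>k. a * (\<bar>t\<bar> ^ 3 / 6 * expectation (\<lambda>x. \<bar>D k x\<bar> ^ 3) + t ^ 4 / 8 * expectation (\<lambda>x. D k x ^ 4))"
  have Z_step: "norm ((CLINT x|M. Z (Suc k) x) - (CLINT x|M. Z k x)) \<le> ?e k" for k
  proof -
    have "(CLINT x|M. Z (Suc k) x) - (CLINT x|M. Z k x) = (CLINT x|M. Z (Suc k) x - Z k x)"
      by (rule Bochner_Integration.integral_diff[OF Z_int Z_int, symmetric])
    also have "\<dots> = (CLINT x|M. Y k x * (iexp (t * D k x) - complex_of_real (exp (- (t\<^sup>2 * v k x / 2)))))"
      by (simp only: step)
    finally show ?thesis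
      using martingale_step[OF sub measurable_M_adapted D4 zero Y_meas Y_le, of k t]
      by (simp only: v_def)
  qed
  have EZ: "norm ((CLINT x|M. Z n x) - 1) \<le> (\<Sum>k<n. ?e k)"
  proof (induction n)
    case 0
    show ?case
      by (simp add: Z_def W_def V'_def prob_space)
  next
    case (Suc n)
    show ?case
      using norm_triangle_ineq[of "(CLINT x|M. Z (Suc n) x) - (CLINT x|M. Z n x)" "(CLINT x|M. Z n x) - 1"]
        Z_step[of n] Suc by simp
  qed
  let ?c = "exp (- (t\<^sup>2 * s / 2))"
  let ?K = "1 + a + a * t\<^sup>2 / 2"
  have c1: "?c \<le> 1" "?c > 0"
    using s by auto
  \<comment> \<open>Below the level \<open>s + 1\<close> the stopping has not acted and the
    exponential is Lipschitz with constant a, which gives a t^2 / 2. Above it the deviation of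
    \<open>V n x\<close> from s exceeds 1 and absorbs the trivial bound 1 + a; this is why the level
    lies one above s. \<open>?K\<close> is the sum of the two constants.\<close>
  have pointwise: "norm (iexp (t * (\<Sum>k<n. D k x)) - complex_of_real ?c * Z n x) \<le> ?K * \<bar>V n x - s\<bar>" for x
  proof (cases "V n x \<le> s + 1")
    case True
    have "V (Suc k) x \<le> s + 1" if "k < n" for k
      using V_mono[of "Suc k" n x] that True by simp
    then have "\<theta> k x = 1" if "k < n" for k
      using that by (simp add: \<theta>_def)
    then have W: "W n x = (\<Sum>k<n. D k x)" and V': "V' n x = V n x"
      by (simp_all add: W_def V'_def V_def)
    have "iexp (t * (\<Sum>k<n. D k x)) - complex_of_real ?c * Z n x
        = iexp (t * W n x) * complex_of_real (1 - ?c * exp (t\<^sup>2 * V n x / 2))"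
      unfolding W[symmetric] Z_def V' by (simp add: algebra_simps)
    then have "norm (iexp (t * (\<Sum>k<n. D k x)) - complex_of_real ?c * Z n x)
        = \<bar>1 - ?c * exp (t\<^sup>2 * V n x / 2)\<bar>"
      by (simp only: norm_mult norm_of_real norm_exp_i_times mult_1_left)
    also have "\<dots> = ?c * \<bar>exp (t\<^sup>2 * s / 2) - exp (t\<^sup>2 * V n x / 2)\<bar>"
    proof -
      have "1 - ?c * exp (t\<^sup>2 * V n x / 2) = ?c * (exp (t\<^sup>2 * s / 2) - exp (t\<^sup>2 * V n x / 2))"
        by (simp add: right_diff_distrib exp_minus)
      then show ?thesis
        by (simp add: abs_mult)
    qed
    also have "\<dots> \<le> 1 * (a * \<bar>t\<^sup>2 * s / 2 - t\<^sup>2 * V n x / 2\<bar>)"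
      unfolding a_def using True c1
      by (intro mult_mono abs_exp_diff_le) (auto intro!: mult_left_mono)
    also have "\<bar>t\<^sup>2 * s / 2 - t\<^sup>2 * V n x / 2\<bar> = t\<^sup>2 / 2 * \<bar>V n x - s\<bar>"
    proof -
      have "t\<^sup>2 * s / 2 - t\<^sup>2 * V n x / 2 = t\<^sup>2 / 2 * (s - V n x)"
        by (simp add: algebra_simps)
      then show ?thesis
        by (simp only:) (simp add: abs_mult abs_minus_commute)
    qed
    also have "1 * (a * (t\<^sup>2 / 2 * \<bar>V n x - s\<bar>)) \<le> ?K * \<bar>V n x - s\<bar>"
      using a1 by (simp add: algebra_simps)
    finally show ?thesis .
  next
    case False
    have "norm (iexp (t * (\<Sum>k<n. D k x)) - complex_of_real ?c * Z n x)
        \<le> norm (iexp (t * (\<Sum>k<n. D k x))) + norm (complex_of_real ?c * Z n x)"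
      by (rule norm_triangle_ineq4)
    also have "\<dots> \<le> 1 + 1 * a"
      unfolding norm_mult using c1 a1 Z_le[of n x]
      by (intro add_mono mult_mono) (auto simp flip: of_real_mult)
    also have "\<dots> \<le> ?K * 1"
      using a1 by simp
    also have "\<dots> \<le> ?K * \<bar>V n x - s\<bar>"
      using False a1 by (intro mult_left_mono add_nonneg_nonneg) auto
    finally show ?thesis .
  qed
  have V_int: "integrable M (\<lambda>x. \<bar>V n x - s\<bar>)"
    unfolding V_def v_def
    by (intro integrable_abs Bochner_Integration.integrable_sum Bochner_Integration.integrable_diff
        integrable_const integrable_cond_square[OF sub measurable_M_adapted D4])
  have i_int: "integrable M (\<lambda>x. iexp (t * (\<Sum>k<n. D k x)))"
    by (rule integrable_const_bound[of _ 1]) (auto simp flip: of_real_mult)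
  have cZ_int: "integrable M (\<lambda>x. complex_of_real ?c * Z n x)"
    using Z_int by simp
  have "(CLINT x|M. iexp (t * (\<Sum>k<n. D k x))) - complex_of_real ?c
      = (CLINT x|M. iexp (t * (\<Sum>k<n. D k x)) - complex_of_real ?c * Z n x)
        + complex_of_real ?c * ((CLINT x|M. Z n x) - 1)"
    unfolding Bochner_Integration.integral_diff[OF i_int cZ_int] by (simp add: algebra_simps)
  then have "norm ((CLINT x|M. iexp (t * (\<Sum>k<n. D k x))) - complex_of_real ?c)
      \<le> norm (CLINT x|M. iexp (t * (\<Sum>k<n. D k x)) - complex_of_real ?c * Z n x)
        + norm (complex_of_real ?c * ((CLINT x|M. Z n x) - 1))"
    by (simp only: norm_triangle_ineq)
  also have "\<dots> \<le> ?K * expectation (\<lambda>x. \<bar>V n x - s\<bar>) + (\<Sum>k<n. ?e k)"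
  proof (rule add_mono)
    have "norm (CLINT x|M. iexp (t * (\<Sum>k<n. D k x)) - complex_of_real ?c * Z n x)
        \<le> expectation (\<lambda>x. norm (iexp (t * (\<Sum>k<n. D k x)) - complex_of_real ?c * Z n x))"
      by (rule integral_norm_bound)
    also have "\<dots> \<le> expectation (\<lambda>x. ?K * \<bar>V n x - s\<bar>)"
      by (intro integral_mono integrable_norm Bochner_Integration.integrable_diff i_int cZ_int
          integrable_mult_right V_int pointwise)
    finally show "norm (CLINT x|M. iexp (t * (\<Sum>k<n. D k x)) - complex_of_real ?c * Z n x)
        \<le> ?K * expectation (\<lambda>x. \<bar>V n x - s\<bar>)"
      by simp
    have "norm (complex_of_real ?c * ((CLINT x|M. Z n x) - 1)) \<le> 1 * (\<Sum>k<n. ?e k)"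
      unfolding norm_mult norm_of_real using c1 EZ by (intro mult_mono) auto
    then show "norm (complex_of_real ?c * ((CLINT x|M. Z n x) - 1)) \<le> (\<Sum>k<n. ?e k)"
      by simp
  qed
  also have "expectation (\<lambda>x. \<bar>V n x - s\<bar>)
      \<le> expectation (\<lambda>x. \<bar>(\<Sum>k<n. (D k x)\<^sup>2) - s\<bar>) + sqrt (\<Sum>k<n. expectation (\<lambda>x. D k x ^ 4))"
    unfolding V_def v_def by (rule expectation_cond_square_deviation)
  also have "(\<Sum>k<n. ?e k) = a * (\<bar>t\<bar> ^ 3 / 6 * (\<Sum>k<n. expectation (\<lambda>x. \<bar>D k x\<bar> ^ 3))
        + t ^ 4 / 8 * (\<Sum>k<n. expectation (\<lambda>x. D k x ^ 4)))"
    by (simp only: sum_distrib_left[symmetric] sum.distrib)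
  finally show ?thesis
    using a1 by (simp add: mult_left_mono)
qed

end

end

section \<open>The transition operator of the chain\<close>

lemma vimage_algebra_factorization_ennreal:
  fixes u :: "'a \<Rightarrow> ennreal"
  assumes Y: "Y \<in> \<Omega> \<rightarrow> space N" and u: "u \<in> borel_measurable (vimage_algebra \<Omega> Y N)"
  shows "\<exists>h\<in>borel_measurable N. \<forall>\<omega>\<in>\<Omega>. u \<omega> = h (Y \<omega>)"
  using u
proof (induction u rule: borel_measurable_induct)
  case (cong f g)
  then show ?case by (simp add: space_vimage_algebra)
next
  case (set A)
  then obtain B where "B \<in> sets N" "A = Y -` B \<inter> \<Omega>"
    unfolding sets_vimage_algebra2[OF Y] by blast
  then show ?case
    by (intro bexI[of _ "indicator B"]) (auto simp: indicator_def)
next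
  case (mult u c)
  then obtain h where "h \<in> borel_measurable N" "\<forall>\<omega>\<in>\<Omega>. u \<omega> = h (Y \<omega>)" by blast
  then show ?case
    by (intro bexI[of _ "\<lambda>y. c * h y"]) auto
next
  case (add u v)
  then obtain h k where "h \<in> borel_measurable N" "\<forall>\<omega>\<in>\<Omega>. u \<omega> = h (Y \<omega>)"
    "k \<in> borel_measurable N" "\<forall>\<omega>\<in>\<Omega>. v \<omega> = k (Y \<omega>)" by blast
  then show ?case
    by (intro bexI[of _ "\<lambda>y. k y + h y"]) auto
next
  case (seq U)
  then obtain h where "\<And>i. h i \<in> borel_measurable N" "\<And>i. \<forall>\<omega>\<in>\<Omega>. U i \<omega> = h i (Y \<omega>)" by metis
  then show ?case
    by (intro bexI[of _ "\<lambda>y. SUP i. h i y"]) (auto simp: image_comp)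
qed

text \<open>Doob-Dynkin lemma. The nonnegative case is an induction over measurable functions; a
  real u is recovered from its positive and negative part, both finite, so the values of the factors
  chosen outside the range of \<open>Y\<close> do no harm.\<close>

lemma vimage_algebra_factorization:
  fixes u :: "'a \<Rightarrow> real"
  assumes Y: "Y \<in> \<Omega> \<rightarrow> space N" and u: "u \<in> borel_measurable (vimage_algebra \<Omega> Y N)"
  shows "\<exists>h\<in>borel_measurable N. \<forall>\<omega>\<in>\<Omega>. u \<omega> = h (Y \<omega>)"
proof -
  have "(\<lambda>\<omega>. ennreal (u \<omega>)) \<in> borel_measurable (vimage_algebra \<Omega> Y N)"
    "(\<lambda>\<omega>. ennreal (- u \<omega>)) \<in> borel_measurable (vimage_algebra \<Omega> Y N)"
    using u by measurable
  then obtain p m where p: "p \<in> borel_measurable N" "\<forall>\<omega>\<in>\<Omega>. ennreal (u \<omega>) = p (Y \<omega>)"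
    and m: "m \<in> borel_measurable N" "\<forall>\<omega>\<in>\<Omega>. ennreal (- u \<omega>) = m (Y \<omega>)"
    using vimage_algebra_factorization_ennreal[OF Y] by metis
  have "u \<omega> = enn2real (p (Y \<omega>)) - enn2real (m (Y \<omega>))" if "\<omega> \<in> \<Omega>" for \<omega>
  proof -
    have "u \<omega> = enn2real (ennreal (u \<omega>)) - enn2real (ennreal (- u \<omega>))"
      by (cases "u \<omega> \<ge> 0") (auto simp: ennreal_neg)
    then show ?thesis
      using that p(2) m(2) by simp
  qed
  then show ?thesis
    using p(1) m(1) by (intro bexI[of _ "\<lambda>y. enn2real (p y) - enn2real (m y)"]) auto
qed

lemma generated_algebra_singleton:
  "generated_algebra M X {i} = vimage_algebra (space M) (X i) borel"
  by (simp add: generated_algebra_def vimage_algebra_def)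

lemma space_generated_algebra [simp]: "space (generated_algebra M X I) = space M"
  unfolding generated_algebra_def by (rule space_measure_of) auto

lemma sets_generated_algebra:
  "sets (generated_algebra M X I)
    = sigma_sets (space M) (\<Union>i\<in>I. {X i -` A \<inter> space M | A. A \<in> sets borel})"
  unfolding generated_algebra_def by (rule sets_measure_of) auto

lemma sets_generated_algebra_mono:
  "I \<subseteq> J \<Longrightarrow> sets (generated_algebra M X I) \<subseteq> sets (generated_algebra M X J)"
  unfolding sets_generated_algebra by (rule sigma_sets_mono') blast

lemma measurable_generated_algebra:
  "i \<in> I \<Longrightarrow> X i \<in> borel_measurable (generated_algebra M X I)"
  by (rule measurableI) (auto simp: sets_generated_algebra intro!: sigma_sets.Basic)

lemma subalgebra_generated_algebra:
  assumes "\<And>i. i \<in> I \<Longrightarrow> X i \<in> borel_measurable M"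
  shows "subalgebra M (generated_algebra M X I)"
proof -
  have "(\<Union>i\<in>I. {X i -` A \<inter> space M | A. A \<in> sets borel}) \<subseteq> sets M"
    using measurable_sets[OF assms] by blast
  then show ?thesis
    unfolding subalgebra_def sets_generated_algebra space_generated_algebra
    by (intro conjI refl sets.sigma_sets_subset)
qed

(* Moving the conditional expectation onto the conditioning event makes the claim linear and
   continuous in g, so that it extends from indicators to integrable g. *)
lemma (in prob_space) cond_exp_eq_of_indicators:
  fixes Y :: "'a \<Rightarrow> real" and g :: "real \<Rightarrow> real"
  assumes F: "subalgebra M F" and G: "subalgebra M G" and GF: "sets G \<subseteq> sets F"
    and Y [measurable]: "Y \<in> borel_measurable M"
    and ind: "\<And>A. A \<in> sets borel \<Longrightarrow> AE \<omega> in M.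
      real_cond_exp M F (\<lambda>\<omega>. indicator A (Y \<omega>)) \<omega> = real_cond_exp M G (\<lambda>\<omega>. indicator A (Y \<omega>)) \<omega>"
    and g [measurable]: "g \<in> borel_measurable borel" and gY: "integrable M (\<lambda>\<omega>. g (Y \<omega>))"
  shows "AE \<omega> in M. real_cond_exp M F (\<lambda>\<omega>. g (Y \<omega>)) \<omega> = real_cond_exp M G (\<lambda>\<omega>. g (Y \<omega>)) \<omega>"
proof -
  interpret F: sigma_finite_subalgebra M F
    by (rule subalgebra_sigma_finite[OF F])
  interpret G: sigma_finite_subalgebra M G
    by (rule subalgebra_sigma_finite[OF G])
  have G_F: "subalgebra F G"
    using F G GF by (simp add: subalgebra_def)
  let ?r = "real_cond_exp M G (\<lambda>\<omega>. g (Y \<omega>))"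
  show ?thesis
  proof (rule F.real_cond_exp_charact[OF _ gY G.real_cond_exp_int(1)[OF gY]])
    show "?r \<in> borel_measurable F"
      by (rule measurable_from_subalg[OF G_F]) measurable
    fix B assume B: "B \<in> sets F"
    have BM [measurable]: "B \<in> sets M"
      using B F by (auto simp: subalgebra_def)
    let ?e = "real_cond_exp M G (indicator B)"
    have B_int: "integrable M (indicator B :: 'a \<Rightarrow> real)"
      by (intro integrable_const_bound[of _ 1]) (auto simp: indicator_def)
    have "AE \<omega> in M. ?e \<omega> \<ge> 0" "AE \<omega> in M. ?e \<omega> \<le> 1"
      by (rule G.real_cond_exp_ge_c[OF B_int] G.real_cond_exp_le_c[OF B_int]; simp add: indicator_def)+
    then have e01: "AE \<omega> in M. \<bar>?e \<omega>\<bar> \<le> 1"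
      by eventually_elim simp
    have eh_int: "integrable M (\<lambda>\<omega>. ?e \<omega> * h \<omega>)" if h: "integrable M h" for h
    proof (rule Bochner_Integration.integrable_bound[OF h])
      show "AE \<omega> in M. norm (?e \<omega> * h \<omega>) \<le> norm (h \<omega>)"
        using e01 by eventually_elim (simp add: abs_mult mult_left_le_one_le)
    qed (use h in measurable)
    have Bh_int: "integrable M (\<lambda>\<omega>. indicator B \<omega> * h \<omega>)" if h: "integrable M h" for h :: "'a \<Rightarrow> real"
      using integrable_mult_indicator[OF BM h] by simp
    have swap: "expectation (\<lambda>\<omega>. ?e \<omega> * h \<omega>) = expectation (\<lambda>\<omega>. indicator B \<omega> * h \<omega>)"
      if h: "integrable M h" and hG: "h \<in> borel_measurable G" for h
      using G.real_cond_exp_intg(2)[OF _ hG, of "indicator B"] Bh_int[OF h]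
      by (simp add: mult.commute)
    have main: "expectation (\<lambda>\<omega>. indicator B \<omega> * h (Y \<omega>)) = expectation (\<lambda>\<omega>. ?e \<omega> * h (Y \<omega>))"
      if "integrable (distr M borel Y) h" for h :: "real \<Rightarrow> real"
      using that
    proof (induction h rule: integrable_induct)
      case (base A c)
      then have A [measurable]: "A \<in> sets borel"
        by simp
      let ?i = "\<lambda>\<omega>. indicator A (Y \<omega>) :: real"
      have i_int: "integrable M ?i"
        using A by (intro integrable_const_bound[of _ 1]) (auto simp: indicator_def)
      \<comment> \<open>Condition on \<open>F\<close>, pass to \<open>G\<close> by
        \<open>ind\<close>, then move the projection onto \<open>G\<close> to the indicator of
        \<open>B\<close> and finally off the indicator of \<open>A\<close>.\<close>
      have "expectation (\<lambda>\<omega>. indicator B \<omega> * ?i \<omega>) = expectation (\<lambda>\<omega>. indicator B \<omega> * real_cond_exp M F ?i \<omega>)"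
        by (rule F.real_cond_exp_intg(2)[OF Bh_int[OF i_int] borel_measurable_indicator[OF B], symmetric])
          measurable
      also have "\<dots> = expectation (\<lambda>\<omega>. indicator B \<omega> * real_cond_exp M G ?i \<omega>)"
      proof (rule integral_cong_AE)
        show "AE \<omega> in M. indicator B \<omega> * real_cond_exp M F ?i \<omega> = indicator B \<omega> * real_cond_exp M G ?i \<omega>"
          using ind[OF A] by eventually_elim simp
      qed measurable
      also have "\<dots> = expectation (\<lambda>\<omega>. ?e \<omega> * real_cond_exp M G ?i \<omega>)"
        by (rule swap[symmetric]) (auto intro: G.real_cond_exp_int i_int)
      also have "\<dots> = expectation (\<lambda>\<omega>. ?e \<omega> * ?i \<omega>)"
        by (rule G.real_cond_exp_intg(2)[OF eh_int[OF i_int]]) measurable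
      finally have "expectation (\<lambda>\<omega>. indicator B \<omega> * ?i \<omega>) * c = expectation (\<lambda>\<omega>. ?e \<omega> * ?i \<omega>) * c"
        by simp
      then show ?case
        by (simp add: mult.assoc[symmetric])
    next
      case (add h1 h2)
      have i: "integrable M (\<lambda>\<omega>. h1 (Y \<omega>))" "integrable M (\<lambda>\<omega>. h2 (Y \<omega>))"
        using add by (auto intro: integrable_distr[OF Y])
      show ?case
        using add Bh_int[OF i(1)] Bh_int[OF i(2)] eh_int[OF i(1)] eh_int[OF i(2)]
        by (simp add: distrib_left)
    next
      case (lim h s)
      have [measurable]: "h \<in> borel_measurable borel" "s i \<in> borel_measurable borel" for i
        using borel_measurable_integrable[OF lim(1)] borel_measurable_integrable[OF lim(4)] by auto
      have h: "integrable M (\<lambda>\<omega>. h (Y \<omega>))"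
        using lim by (auto intro: integrable_distr[OF Y])
      have s: "(\<lambda>i. s i y) \<longlonglongrightarrow> h y" "norm (s i y) \<le> 2 * norm (h y)" for i y
        using lim(2,3) by auto
      have "(\<lambda>i. expectation (\<lambda>\<omega>. indicator B \<omega> * s i (Y \<omega>))) \<longlonglongrightarrow> expectation (\<lambda>\<omega>. indicator B \<omega> * h (Y \<omega>))"
      proof (rule integral_dominated_convergence)
        show "integrable M (\<lambda>\<omega>. 2 * norm (h (Y \<omega>)))"
          using h by simp
        show "AE \<omega> in M. (\<lambda>i. indicator B \<omega> * s i (Y \<omega>)) \<longlonglongrightarrow> indicator B \<omega> * h (Y \<omega>)"
          using s by (intro AE_I2 tendsto_intros) auto
        show "AE \<omega> in M. norm (indicator B \<omega> * s i (Y \<omega>)) \<le> 2 * norm (h (Y \<omega>))" for i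
          using s(2) by (intro AE_I2) (auto simp: indicator_def)
      qed measurable
      moreover have "(\<lambda>i. expectation (\<lambda>\<omega>. ?e \<omega> * s i (Y \<omega>))) \<longlonglongrightarrow> expectation (\<lambda>\<omega>. ?e \<omega> * h (Y \<omega>))"
      proof (rule integral_dominated_convergence)
        show "integrable M (\<lambda>\<omega>. 2 * norm (h (Y \<omega>)))"
          using h by simp
        show "AE \<omega> in M. (\<lambda>i. ?e \<omega> * s i (Y \<omega>)) \<longlonglongrightarrow> ?e \<omega> * h (Y \<omega>)"
          using s by (intro AE_I2 tendsto_intros) auto
        show "AE \<omega> in M. norm (?e \<omega> * s i (Y \<omega>)) \<le> 2 * norm (h (Y \<omega>))" for i
          using e01
        proof eventually_elim
          case (elim \<omega>)
          have "norm (?e \<omega> * s i (Y \<omega>)) \<le> 1 * norm (s i (Y \<omega>))"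
            unfolding norm_mult using elim by (intro mult_right_mono) auto
          then show ?case
            using s(2)[of i "Y \<omega>"] by simp
        qed
      qed measurable
      ultimately show ?case
        using lim by (auto intro: LIMSEQ_unique)
    qed
    have "set_lebesgue_integral M B (\<lambda>\<omega>. g (Y \<omega>)) = expectation (\<lambda>\<omega>. indicator B \<omega> * g (Y \<omega>))"
      by (simp add: set_lebesgue_integral_def)
    also have "\<dots> = expectation (\<lambda>\<omega>. ?e \<omega> * g (Y \<omega>))"
      using gY by (intro main) (simp add: integrable_distr_eq)
    also have "\<dots> = expectation (\<lambda>\<omega>. ?e \<omega> * ?r \<omega>)"
      by (rule G.real_cond_exp_intg(2)[OF eh_int[OF gY], symmetric]) measurable
    also have "\<dots> = expectation (\<lambda>\<omega>. indicator B \<omega> * ?r \<omega>)"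
      by (rule swap[OF G.real_cond_exp_int(1)[OF gY]]) measurable
    also have "\<dots> = set_lebesgue_integral M B ?r"
      by (simp add: set_lebesgue_integral_def)
    finally show "set_lebesgue_integral M B (\<lambda>\<omega>. g (Y \<omega>)) = set_lebesgue_integral M B ?r" .
  qed
qed

section \<open>Time shifts and a time-independent transition function\<close>

locale stationary_reversible_chain = prob_space M for M :: "'a measure" +
  fixes X :: "int \<Rightarrow> 'a \<Rightarrow> real"
  assumes markov: "markov_chain M X"
    and stationary: "strictly_stationary M X"
    and reversible: "reversible M X"
begin

abbreviation past :: "int \<Rightarrow> 'a measure" where
  "past k \<equiv> generated_algebra M X {..k}"

lemma measurable_X [measurable]: "X i \<in> borel_measurable M"
  using markov by (simp add: markov_chain_def)

lemma subalgebra_past: "subalgebra M (generated_algebra M X I)"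
  by (rule subalgebra_generated_algebra) measurable

lemma measurable_past: "i \<le> k \<Longrightarrow> X i \<in> borel_measurable (past k)"
  by (rule measurable_generated_algebra) simp

text \<open>A pair of values is a projection of the path, so its law inherits the shift invariance
  of the path law.\<close>

lemma distr_shift:
  "distr M (borel \<Otimes>\<^sub>M borel) (\<lambda>\<omega>. (X (i + h) \<omega>, X (j + h) \<omega>))
    = distr M (borel \<Otimes>\<^sub>M borel) (\<lambda>\<omega>. (X i \<omega>, X j \<omega>))"
proof -
  let ?P = "PiM UNIV (\<lambda>_. borel) :: (int \<Rightarrow> real) measure"
  have X_P: "(\<lambda>\<omega> i. X (i + h) \<omega>) \<in> measurable M ?P" for h
    by (rule measurable_PiM_single') auto
  have pr: "(\<lambda>x. (x i, x j)) \<in> measurable ?P (borel \<Otimes>\<^sub>M borel)"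
    by measurable
  have "distr M (borel \<Otimes>\<^sub>M borel) (\<lambda>\<omega>. (X (i + h) \<omega>, X (j + h) \<omega>))
      = distr (distr M ?P (\<lambda>\<omega> i. X (i + h) \<omega>)) (borel \<Otimes>\<^sub>M borel) (\<lambda>x. (x i, x j))" for h
    by (simp add: distr_distr[OF pr X_P] comp_def)
  \<comment> \<open>The instance at 0 brings the unshifted pair into the same form.\<close>
  from this[of h] this[of 0] show ?thesis
    using stationary by (simp add: strictly_stationary_def)
qed

lemma integrable_shift_pair:
  fixes \<phi> :: "real \<times> real \<Rightarrow> real"
  assumes [measurable]: "\<phi> \<in> borel_measurable (borel \<Otimes>\<^sub>M borel)"
  shows "integrable M (\<lambda>\<omega>. \<phi> (X (i + h) \<omega>, X (j + h) \<omega>)) \<longleftrightarrow> integrable M (\<lambda>\<omega>. \<phi> (X i \<omega>, X j \<omega>))"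
    and "expectation (\<lambda>\<omega>. \<phi> (X (i + h) \<omega>, X (j + h) \<omega>)) = expectation (\<lambda>\<omega>. \<phi> (X i \<omega>, X j \<omega>))"
proof -
  have m: "(\<lambda>\<omega>. (X i \<omega>, X j \<omega>)) \<in> measurable M (borel \<Otimes>\<^sub>M borel)" for i j
    by measurable
  show "integrable M (\<lambda>\<omega>. \<phi> (X (i + h) \<omega>, X (j + h) \<omega>)) \<longleftrightarrow> integrable M (\<lambda>\<omega>. \<phi> (X i \<omega>, X j \<omega>))"
    using integrable_distr_eq[OF m assms, of "i + h" "j + h"] integrable_distr_eq[OF m assms, of i j]
    by (simp add: distr_shift)
  show "expectation (\<lambda>\<omega>. \<phi> (X (i + h) \<omega>, X (j + h) \<omega>)) = expectation (\<lambda>\<omega>. \<phi> (X i \<omega>, X j \<omega>))"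
    using integral_distr[OF m assms, of "i + h" "j + h"] integral_distr[OF m assms, of i j]
    by (simp add: distr_shift)
qed

lemma integrable_stationary:
  fixes g :: "real \<Rightarrow> real"
  assumes [measurable]: "g \<in> borel_measurable borel"
  shows "integrable M (\<lambda>\<omega>. g (X i \<omega>)) \<longleftrightarrow> integrable M (\<lambda>\<omega>. g (X 0 \<omega>))"
  using integrable_shift_pair(1)[of "\<lambda>p. g (fst p)" 0 i 0] by simp

lemma expectation_stationary:
  fixes g :: "real \<Rightarrow> real"
  assumes [measurable]: "g \<in> borel_measurable borel"
  shows "expectation (\<lambda>\<omega>. g (X i \<omega>)) = expectation (\<lambda>\<omega>. g (X 0 \<omega>))"
  using integrable_shift_pair(2)[of "\<lambda>p. g (fst p)" 0 i 0] by simp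

text \<open>\<open>markov_chain\<close> lets the transition law depend on time; stationarity removes
  this dependence. The function h is found at times 0 and 1 by factorization through
  \<open>X 0\<close>, and the shift invariance of the law of pairs shows that it serves every
  k.\<close>

lemma transition_exists:
  fixes g :: "real \<Rightarrow> real"
  assumes [measurable]: "g \<in> borel_measurable borel" and g: "integrable M (\<lambda>\<omega>. g (X 0 \<omega>))"
  shows "\<exists>h\<in>borel_measurable borel. \<forall>k. AE \<omega> in M.
    real_cond_exp M (past k) (\<lambda>\<omega>. g (X (k + 1) \<omega>)) \<omega> = h (X k \<omega>)"
proof -
  have gi: "integrable M (\<lambda>\<omega>. g (X i \<omega>))" for i
    using g integrable_stationary[of g i] by simp
  have "real_cond_exp M (generated_algebra M X {0}) (\<lambda>\<omega>. g (X 1 \<omega>))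
      \<in> borel_measurable (vimage_algebra (space M) (X 0) borel)"
    unfolding generated_algebra_singleton by measurable
  then have "\<exists>h\<in>borel_measurable borel. \<forall>\<omega>\<in>space M.
      real_cond_exp M (generated_algebra M X {0}) (\<lambda>\<omega>. g (X 1 \<omega>)) \<omega> = h (X 0 \<omega>)"
    by (intro vimage_algebra_factorization) auto
  then obtain h where h [measurable]: "h \<in> borel_measurable borel"
    and h_eq: "\<And>\<omega>. \<omega> \<in> space M \<Longrightarrow>
      real_cond_exp M (generated_algebra M X {0}) (\<lambda>\<omega>. g (X 1 \<omega>)) \<omega> = h (X 0 \<omega>)"
    by blast
  interpret G0: sigma_finite_subalgebra M "generated_algebra M X {0}"
    by (rule subalgebra_sigma_finite[OF subalgebra_past])
  have h0: "integrable M (\<lambda>\<omega>. h (X 0 \<omega>))"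
    by (rule Bochner_Integration.integrable_cong[THEN iffD1, OF refl h_eq G0.real_cond_exp_int(1)[OF gi]])
  then have hi: "integrable M (\<lambda>\<omega>. h (X i \<omega>))" for i
    using integrable_stationary[of h i] by simp
  have "AE \<omega> in M. real_cond_exp M (past k) (\<lambda>\<omega>. g (X (k + 1) \<omega>)) \<omega> = h (X k \<omega>)" for k
  proof -
    interpret Gk: sigma_finite_subalgebra M "generated_algebra M X {k}"
      by (rule subalgebra_sigma_finite[OF subalgebra_past])
    have "AE \<omega> in M. real_cond_exp M (past k) (\<lambda>\<omega>. g (X (k + 1) \<omega>)) \<omega>
        = real_cond_exp M (generated_algebra M X {k}) (\<lambda>\<omega>. g (X (k + 1) \<omega>)) \<omega>"
    proof (rule cond_exp_eq_of_indicators[OF subalgebra_past subalgebra_past _ measurable_X _ assms(1) gi])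
      show "sets (generated_algebra M X {k}) \<subseteq> sets (past k)"
        by (rule sets_generated_algebra_mono) simp
    qed (use markov in \<open>simp add: markov_chain_def\<close>)
    moreover have "AE \<omega> in M. real_cond_exp M (generated_algebra M X {k}) (\<lambda>\<omega>. g (X (k + 1) \<omega>)) \<omega> = h (X k \<omega>)"
    proof (rule Gk.real_cond_exp_charact[OF _ gi hi])
      have "X k \<in> borel_measurable (generated_algebra M X {k})"
        by (rule measurable_generated_algebra) simp
      then show "(\<lambda>\<omega>. h (X k \<omega>)) \<in> borel_measurable (generated_algebra M X {k})"
        by measurable
      \<comment> \<open>Events generated by \<open>X k\<close> are preimages of Borel sets, so the
        identity to be checked involves only the pair at times k and k + 1 and can be carried back
        to times 0 and 1.\<close>
      fix B assume "B \<in> sets (generated_algebra M X {k})"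
      then obtain A where A [measurable]: "A \<in> sets borel" and B: "B = X k -` A \<inter> space M"
        unfolding generated_algebra_singleton by (subst (asm) sets_vimage_algebra2) auto
      let ?B0 = "X 0 -` A \<inter> space M"
      have B0: "?B0 \<in> sets (generated_algebra M X {0})"
        unfolding generated_algebra_singleton by (rule in_vimage_algebra[OF A])
      have "set_lebesgue_integral M B (\<lambda>\<omega>. g (X (k + 1) \<omega>)) = expectation (\<lambda>\<omega>. indicator A (X k \<omega>) * g (X (k + 1) \<omega>))"
        unfolding B set_lebesgue_integral_def
        by (intro Bochner_Integration.integral_cong refl) (auto simp: indicator_def)
      also have "\<dots> = expectation (\<lambda>\<omega>. indicator A (X 0 \<omega>) * g (X 1 \<omega>))"
        using integrable_shift_pair(2)[of "\<lambda>(x, y). indicator A x * g y" 0 k 1] by (simp add: add.commute)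
      also have "\<dots> = set_lebesgue_integral M ?B0 (\<lambda>\<omega>. g (X 1 \<omega>))"
        unfolding set_lebesgue_integral_def
        by (intro Bochner_Integration.integral_cong refl) (auto simp: indicator_def)
      also have "\<dots> = set_lebesgue_integral M ?B0 (real_cond_exp M (generated_algebra M X {0}) (\<lambda>\<omega>. g (X 1 \<omega>)))"
        by (rule G0.real_cond_exp_intA[OF gi B0])
      also have "\<dots> = expectation (\<lambda>\<omega>. indicator A (X 0 \<omega>) * h (X 0 \<omega>))"
        unfolding set_lebesgue_integral_def
        by (intro Bochner_Integration.integral_cong refl) (auto simp: indicator_def h_eq)
      also have "\<dots> = expectation (\<lambda>\<omega>. indicator A (X k \<omega>) * h (X k \<omega>))"
        using expectation_stationary[of "\<lambda>x. indicator A x * h x" k] by simp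
      also have "\<dots> = set_lebesgue_integral M B (\<lambda>\<omega>. h (X k \<omega>))"
        unfolding B set_lebesgue_integral_def
        by (intro Bochner_Integration.integral_cong refl) (auto simp: indicator_def)
      finally show "set_lebesgue_integral M B (\<lambda>\<omega>. g (X (k + 1) \<omega>)) = set_lebesgue_integral M B (\<lambda>\<omega>. h (X k \<omega>))" .
    qed
    ultimately show ?thesis
      by eventually_elim simp
  qed
  then show ?thesis
    using h by blast
qed

end

section \<open>Autocorrelations of a reversible chain\<close>

context
  fixes r :: "nat \<Rightarrow> real"
  assumes even_antimono: "\<And>m. r (2 * m + 2) \<le> r (2 * m)"
    and odd_le: "\<And>m. \<bar>r (2 * m + 1)\<bar> \<le> r (2 * m)"
begin

text \<open>\<open>odd_le\<close> also makes the even terms nonnegative, so each |r k| is at most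
  the last even term up to k, and the even terms decrease.\<close>

lemma abs_le_initial: "\<bar>r k\<bar> \<le> r 0"
proof -
  have even_le: "r (2 * m) \<le> r 0" for m
  proof (induction m)
    case (Suc m)
    then show ?case
      using even_antimono[of m] by simp
  qed simp
  have "0 \<le> r (2 * m)" for m
    using odd_le[of m] by linarith
  then show ?thesis
    using odd_le[of "k div 2"] even_le[of "k div 2"]
    by (cases "even k") (auto elim!: evenE oddE)
qed

text \<open>The range from p to q splits into pairs starting at an even index, each with nonnegative
  sum by \<open>odd_le\<close>; a single term left over at the end has even index and is nonnegative
  too.\<close>

lemma partial_sum_mono_even:
  assumes "even p" "p \<le> q"
  shows "(\<Sum>k<p. r k) \<le> (\<Sum>k<q. r k)"
proof -
  have pair: "(\<Sum>k<2 * i. r k) \<le> (\<Sum>k<2 * Suc i. r k)" for i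
    using odd_le[of i] by simp
  have even_mono: "(\<Sum>k<2 * i. r k) \<le> (\<Sum>k<2 * j. r k)" if "i \<le> j" for i j
    using that by (rule lift_Suc_mono_le[of "\<lambda>i. \<Sum>k<2 * i. r k", OF pair])
  obtain i where i: "p = 2 * i"
    using assms(1) by (rule evenE)
  show ?thesis
  proof (cases "even q")
    case True
    then obtain j where "q = 2 * j" by (rule evenE)
    then show ?thesis
      using even_mono[of i j] assms(2) i by simp
  next
    case False
    then obtain j where j: "q = 2 * j + 1" by (rule oddE)
    then have "i \<le> j"
      using assms(2) i by simp
    then show ?thesis
      using even_mono[of i j] odd_le[of j] i j by simp
  qed
qed

lemma partial_sum_nonneg: "0 \<le> (\<Sum>k<q. r k)"
  using partial_sum_mono_even[of 0 q] by simp

text \<open>For odd p the sum is one term away from one of even length, and |r p| \<le> r 0 pays for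
  it. The step beyond q matters: the variance of a sum of n terms of \<open>Q g\<close> involves
  lags up to n - 1, whereas the covariances in the hypothesis provide them up to n - 2.\<close>

lemma partial_sum_le:
  assumes "p \<le> Suc q"
  shows "(\<Sum>k<p. r k) \<le> (\<Sum>k<q. r k) + r 0"
proof -
  consider "p = Suc q" | "p = q" | "even p" "p \<le> q" | "odd p" "Suc p \<le> q"
    using assms by linarith
  then show ?thesis
  proof cases
    case 1
    then show ?thesis
      using abs_le_initial[of q] by simp
  next
    case 2
    then show ?thesis
      using abs_le_initial[of 0] by simp
  next
    case 3
    then show ?thesis
      using partial_sum_mono_even[of p q] abs_le_initial[of 0] by simp
  next
    case 4
    then show ?thesis
      using partial_sum_mono_even[of "Suc p" q] abs_le_initial[of p] by simp
  qed
qed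

end

text \<open>The variance of a stationary sum is arranged as a sum of partial sums of
  autocovariances, rather than with weights n - k, so that the comparison of partial sums applies
  termwise.\<close>

lemma expectation_square_sum_stationary:
  fixes Z :: "nat \<Rightarrow> 'a \<Rightarrow> real" and r :: "nat \<Rightarrow> real"
  assumes [measurable]: "\<And>i. Z i \<in> borel_measurable M"
    and Z2: "\<And>i. integrable M (\<lambda>x. (Z i x)\<^sup>2)"
    and cov: "\<And>i k. integral\<^sup>L M (\<lambda>x. Z i x * Z (i + k) x) = r k"
  shows "integral\<^sup>L M (\<lambda>x. (\<Sum>i<n. Z i x)\<^sup>2) = 2 * (\<Sum>m<n. \<Sum>k<Suc m. r k) - real n * r 0"
proof (induction n)
  case 0
  show ?case by simp
next
  case (Suc n)
  let ?S = "\<lambda>x. \<Sum>i<n. Z i x"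
  have S2: "integrable M (\<lambda>x. (?S x)\<^sup>2)"
    by (intro integrable_square_sum Z2) measurable
  have ZZ: "integrable M (\<lambda>x. Z i x * Z n x)" for i
    by (intro integrable_mult_of_squares Z2) measurable
  have "integral\<^sup>L M (\<lambda>x. (\<Sum>i<Suc n. Z i x)\<^sup>2)
      = integral\<^sup>L M (\<lambda>x. (?S x)\<^sup>2 + 2 * (\<Sum>i<n. Z i x * Z n x) + (Z n x)\<^sup>2)"
    unfolding sum.lessThan_Suc power2_sum
    by (intro Bochner_Integration.integral_cong refl) (simp add: sum_distrib_right mult.assoc)
  also have "\<dots> = integral\<^sup>L M (\<lambda>x. (?S x)\<^sup>2) + 2 * (\<Sum>i<n. integral\<^sup>L M (\<lambda>x. Z i x * Z n x))
      + integral\<^sup>L M (\<lambda>x. (Z n x)\<^sup>2)"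
    using S2 ZZ Z2
    by (simp only: Bochner_Integration.integral_add Bochner_Integration.integral_sum integral_mult_right_zero
        Bochner_Integration.integrable_add Bochner_Integration.integrable_sum integrable_mult_right)
  also have "integral\<^sup>L M (\<lambda>x. (Z n x)\<^sup>2) = r 0"
    using cov[of n 0] by (simp add: power2_eq_square)
  also have "(\<Sum>i<n. integral\<^sup>L M (\<lambda>x. Z i x * Z n x)) = (\<Sum>i<n. r (n - i))"
  proof (rule sum.cong)
    fix i assume "i \<in> {..<n}"
    then show "integral\<^sup>L M (\<lambda>x. Z i x * Z n x) = r (n - i)"
      using cov[of i "n - i"] by simp
  qed simp
  also have "(\<Sum>i<n. r (n - i)) = (\<Sum>k<n. r (Suc k))"
    using sum.nat_diff_reindex[of "\<lambda>k. r (Suc k)" n] by (simp add: Suc_diff_Suc)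
  also have "\<dots> = (\<Sum>k<Suc n. r k) - r 0"
    unfolding sum.lessThan_Suc_shift by simp
  finally show ?case
    unfolding Suc by (simp add: algebra_simps)
qed

section \<open>The self-adjoint operator \<open>Q\<close> and the autocovariances\<close>

context stationary_reversible_chain
begin

(* An arbitrary function unless g is integrable under the marginal law. *)
definition Q :: "(real \<Rightarrow> real) \<Rightarrow> real \<Rightarrow> real" where
  "Q g = (SOME h. h \<in> borel_measurable borel \<and> (\<forall>k. AE \<omega> in M.
    real_cond_exp M (past k) (\<lambda>\<omega>. g (X (k + 1) \<omega>)) \<omega> = h (X k \<omega>)))"

definition square_int :: "(real \<Rightarrow> real) \<Rightarrow> bool" where
  "square_int g \<longleftrightarrow> g \<in> borel_measurable borel \<and> integrable M (\<lambda>\<omega>. (g (X 0 \<omega>))\<^sup>2)"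

text \<open>Uncentred, hence the covariance at lag k when one of the functions has mean zero. Two
  separate functions allow \<open>Q\<close> to be moved onto either side.\<close>

definition corr :: "(real \<Rightarrow> real) \<Rightarrow> (real \<Rightarrow> real) \<Rightarrow> nat \<Rightarrow> real" where
  "corr g u k = expectation (\<lambda>\<omega>. g (X 0 \<omega>) * u (X (int k) \<omega>))"

lemma Q_characterization:
  assumes "g \<in> borel_measurable borel" "integrable M (\<lambda>\<omega>. g (X 0 \<omega>))"
  shows "Q g \<in> borel_measurable borel"
    and "AE \<omega> in M. real_cond_exp M (past k) (\<lambda>\<omega>. g (X (k + 1) \<omega>)) \<omega> = Q g (X k \<omega>)"
proof -
  have "\<exists>h. h \<in> borel_measurable borel \<and> (\<forall>k. AE \<omega> in M.
      real_cond_exp M (past k) (\<lambda>\<omega>. g (X (k + 1) \<omega>)) \<omega> = h (X k \<omega>))"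
    using transition_exists[OF assms] by blast
  from someI_ex[OF this] show "Q g \<in> borel_measurable borel"
    and "AE \<omega> in M. real_cond_exp M (past k) (\<lambda>\<omega>. g (X (k + 1) \<omega>)) \<omega> = Q g (X k \<omega>)"
    unfolding Q_def[symmetric] by auto
qed

text \<open>Contraction of \<open>Q\<close> in L^m: conditional Jensen, then stationarity to return
  from time 1 to time 0. It is applied with m = 2 and m = 4.\<close>

lemma transition_power_le:
  assumes g [measurable]: "g \<in> borel_measurable borel"
    and gm: "integrable M (\<lambda>\<omega>. g (X 0 \<omega>) ^ m)" and m: "even m" "m \<ge> 1"
  shows "integrable M (\<lambda>\<omega>. Q g (X 0 \<omega>) ^ m)"
    and "expectation (\<lambda>\<omega>. Q g (X 0 \<omega>) ^ m) \<le> expectation (\<lambda>\<omega>. g (X 0 \<omega>) ^ m)"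
proof -
  have gX: "(\<lambda>\<omega>. g (X i \<omega>)) \<in> borel_measurable M" for i
    by measurable
  have "integrable M (\<lambda>\<omega>. \<bar>g (X 0 \<omega>)\<bar> ^ 1)"
    using m by (intro integrable_power_le[OF gX gm]) auto
  then have g1: "integrable M (\<lambda>\<omega>. g (X 0 \<omega>))"
    by (simp add: integrable_abs_iff)
  note [measurable] = Q_characterization(1)[OF g g1]
  have i1: "integrable M (\<lambda>\<omega>. g (X (0 + 1) \<omega>) ^ m)"
    using gm integrable_stationary[of "\<lambda>x. g x ^ m" 1] by simp
  note J = cond_exp_power_le[OF subalgebra_past gX i1 m, of "{..0}"]
  have AE: "AE \<omega> in M. Q g (X 0 \<omega>) ^ m = real_cond_exp M (past 0) (\<lambda>\<omega>. g (X (0 + 1) \<omega>)) \<omega> ^ m"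
    using Q_characterization(2)[OF g g1, of 0] by eventually_elim simp
  show "integrable M (\<lambda>\<omega>. Q g (X 0 \<omega>) ^ m)"
    by (rule Bochner_Integration.integrable_cong_AE[THEN iffD2, OF _ _ AE J(1)]) measurable
  have "expectation (\<lambda>\<omega>. Q g (X 0 \<omega>) ^ m)
      = expectation (\<lambda>\<omega>. real_cond_exp M (past 0) (\<lambda>\<omega>. g (X (0 + 1) \<omega>)) \<omega> ^ m)"
    by (rule integral_cong_AE[OF _ _ AE]) measurable
  also have "\<dots> \<le> expectation (\<lambda>\<omega>. g (X (0 + 1) \<omega>) ^ m)"
    by (rule J(2))
  also have "\<dots> = expectation (\<lambda>\<omega>. g (X 0 \<omega>) ^ m)"
    using expectation_stationary[of "\<lambda>x. g x ^ m" 1] by simp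
  finally show "expectation (\<lambda>\<omega>. Q g (X 0 \<omega>) ^ m) \<le> expectation (\<lambda>\<omega>. g (X 0 \<omega>) ^ m)" .
qed

lemma square_int_measurable: "square_int g \<Longrightarrow> g \<in> borel_measurable borel"
  by (simp add: square_int_def)

lemma square_int_integrable:
  assumes "square_int g"
  shows "integrable M (\<lambda>\<omega>. (g (X i \<omega>))\<^sup>2)" and "integrable M (\<lambda>\<omega>. g (X i \<omega>))"
proof -
  have [measurable]: "g \<in> borel_measurable borel"
    using assms by (simp add: square_int_def)
  show *: "integrable M (\<lambda>\<omega>. (g (X i \<omega>))\<^sup>2)"
    using assms integrable_stationary[of "\<lambda>x. (g x)\<^sup>2" i] by (simp add: square_int_def)
  show "integrable M (\<lambda>\<omega>. g (X i \<omega>))"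
    by (rule integrable_of_square[OF _ *]) measurable
qed

lemma square_int_transition:
  assumes "square_int g"
  shows "square_int (Q g)"
  using assms Q_characterization(1)[of g] transition_power_le(1)[of g 2] square_int_integrable(2)[of g 0]
  by (simp add: square_int_def)

lemma corr_shift:
  assumes "square_int g" "square_int u"
  shows "expectation (\<lambda>\<omega>. g (X i \<omega>) * u (X (i + int k) \<omega>)) = corr g u k"
proof -
  note [measurable] = assms[THEN square_int_measurable]
  show ?thesis
    using integrable_shift_pair(2)[of "\<lambda>(x, y). g x * u y" 0 i "int k"] by (simp add: corr_def add.commute)
qed

lemma corr_0_commute: "corr g u 0 = corr u g 0"
  by (simp add: corr_def mult.commute)

text \<open>Reversibility enters through this symmetry at lag 1, to which longer lags are
  reduced.\<close>

lemma corr_1_commute: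
  assumes "square_int g" "square_int u"
  shows "corr g u (Suc 0) = corr u g (Suc 0)"
proof -
  note [measurable] = assms[THEN square_int_measurable]
  have \<phi>: "(\<lambda>(x, y). g x * u y) \<in> borel_measurable (borel \<Otimes>\<^sub>M borel)"
    by measurable
  have m: "(\<lambda>\<omega>. (X i \<omega>, X j \<omega>)) \<in> measurable M (borel \<Otimes>\<^sub>M borel)" for i j
    by measurable
  show ?thesis
    using integral_distr[OF m \<phi>, of 0 1] integral_distr[OF m \<phi>, of 1 0] reversible
    by (simp add: corr_def reversible_def mult.commute)
qed

text \<open>The Markov property: condition on the past up to time k, where
  \<open>g (X 0 \<omega>)\<close> is known.\<close>

lemma corr_Suc:
  assumes g: "square_int g" and u: "square_int u"
  shows "corr g u (Suc k) = corr g (Q u) k"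
proof -
  note [measurable] = g[THEN square_int_measurable] u[THEN square_int_measurable]
    square_int_transition[OF u, THEN square_int_measurable]
  interpret P: sigma_finite_subalgebra M "past (int k)"
    by (rule subalgebra_sigma_finite[OF subalgebra_past])
  have "X 0 \<in> borel_measurable (past (int k))"
    by (rule measurable_past) simp
  then have gX: "(\<lambda>\<omega>. g (X 0 \<omega>)) \<in> borel_measurable (past (int k))"
    by measurable
  have i: "integrable M (\<lambda>\<omega>. g (X 0 \<omega>) * u (X (int k + 1) \<omega>))"
    by (intro integrable_mult_of_squares square_int_integrable g u) measurable
  have AE: "AE \<omega> in M. g (X 0 \<omega>) * real_cond_exp M (past (int k)) (\<lambda>\<omega>. u (X (int k + 1) \<omega>)) \<omega>
      = g (X 0 \<omega>) * Q u (X (int k) \<omega>)"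
    using Q_characterization(2)[OF square_int_measurable[OF u] square_int_integrable(2)[OF u], of "int k"]
    by eventually_elim simp
  have "corr g u (Suc k) = expectation (\<lambda>\<omega>. g (X 0 \<omega>) * u (X (int k + 1) \<omega>))"
    by (simp add: corr_def add.commute)
  also have "\<dots> = expectation (\<lambda>\<omega>. g (X 0 \<omega>) * real_cond_exp M (past (int k)) (\<lambda>\<omega>. u (X (int k + 1) \<omega>)) \<omega>)"
    by (rule P.real_cond_exp_intg(2)[OF i gX, symmetric]) measurable
  also have "\<dots> = corr g (Q u) k"
    unfolding corr_def by (rule integral_cong_AE[OF _ _ AE]) measurable
  finally show ?thesis .
qed

text \<open>Self-adjointness of \<open>Q\<close>. At lag 1 the functions are swapped,
  \<open>corr_Suc\<close> is applied, and they are swapped back at lag 0. At a longer lag one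
  \<open>Q\<close> is stored in u, the induction hypothesis is used for \<open>Q u\<close>, and the
  stored factor is released again.\<close>

lemma corr_Suc_left:
  assumes g: "square_int g" and u: "square_int u"
  shows "corr g u (Suc k) = corr (Q g) u k"
  using u
proof (induction k arbitrary: u)
  case 0
  then show ?case
    using corr_1_commute[OF g 0] corr_Suc[OF 0 g] corr_0_commute by simp
next
  case (Suc k)
  then show ?case
    using corr_Suc[OF g Suc.prems] corr_Suc[OF square_int_transition[OF g] Suc.prems]
      Suc.IH[OF square_int_transition[OF Suc.prems]] by simp
qed

lemma autocorr_Suc_Suc:
  assumes g: "square_int g"
  shows "corr g g (Suc (Suc k)) = corr (Q g) (Q g) k"
  using corr_Suc_left[OF g g] corr_Suc[OF square_int_transition[OF g] g] by simp

lemma autocorr_0_antimono: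
  assumes g: "square_int g"
  shows "corr (Q g) (Q g) 0 \<le> corr g g 0"
  using transition_power_le(2)[of g 2] g by (simp add: corr_def square_int_def power2_eq_square)

lemma autocorr_1_le:
  assumes g: "square_int g"
  shows "\<bar>corr g g (Suc 0)\<bar> \<le> corr g g 0"
proof -
  note [measurable] = g[THEN square_int_measurable]
  have "expectation (\<lambda>\<omega>. (g (X 1 \<omega>))\<^sup>2) = corr g g 0" "expectation (\<lambda>\<omega>. (g (X 0 \<omega>))\<^sup>2) = corr g g 0"
    using expectation_stationary[of "\<lambda>x. (g x)\<^sup>2" 1] by (simp_all add: corr_def power2_eq_square)
  then have "expectation (\<lambda>\<omega>. \<bar>g (X 0 \<omega>) * g (X 1 \<omega>)\<bar>) \<le> sqrt (corr g g 0 * corr g g 0)"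
    using integral_abs_mult_le_sqrt[OF _ _ square_int_integrable(1)[OF g] square_int_integrable(1)[OF g], of 0 1]
    by simp
  moreover have "\<bar>corr g g (Suc 0)\<bar> \<le> expectation (\<lambda>\<omega>. \<bar>g (X 0 \<omega>) * g (X 1 \<omega>)\<bar>)"
    unfolding corr_def using integral_abs_bound[of M "\<lambda>\<omega>. g (X 0 \<omega>) * g (X 1 \<omega>)"] by simp
  moreover have "corr g g 0 \<ge> 0"
    by (simp add: corr_def)
  ultimately show ?thesis
    by simp
qed

text \<open>Replacing g by \<open>Q g\<close> lowers all lags by two, so the induction runs over all
  g at once and starts from lags 0, 1 and 2, where contraction and Cauchy-Schwarz suffice.\<close>

lemma autocorr_even_odd:
  assumes "square_int g"
  shows "corr g g (2 * m + 2) \<le> corr g g (2 * m)" and "\<bar>corr g g (2 * m + 1)\<bar> \<le> corr g g (2 * m)"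
proof -
  have "corr g g (2 * m + 2) \<le> corr g g (2 * m) \<and> \<bar>corr g g (2 * m + 1)\<bar> \<le> corr g g (2 * m)"
    using assms
  proof (induction m arbitrary: g)
    case 0
    then show ?case
      using autocorr_Suc_Suc[OF 0, of 0] autocorr_0_antimono[OF 0] autocorr_1_le[OF 0]
      by (simp add: numeral_2_eq_2)
  next
    case (Suc m)
    then show ?case
      using Suc.IH[OF square_int_transition[OF Suc.prems]] autocorr_Suc_Suc[OF Suc.prems] by simp
  qed
  then show "corr g g (2 * m + 2) \<le> corr g g (2 * m)" "\<bar>corr g g (2 * m + 1)\<bar> \<le> corr g g (2 * m)"
    by auto
qed

text \<open>All n inner partial sums have length at most \<open>Suc q\<close>, so one bound serves
  them all, and the negative term of the variance formula is dropped. The starting time c is free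
  because only lags enter.\<close>

lemma expectation_square_sum_le:
  assumes g: "square_int g" and n: "n \<le> Suc q"
  shows "expectation (\<lambda>\<omega>. (\<Sum>i<n. g (X (c + int i) \<omega>))\<^sup>2)
    \<le> 2 * real n * ((\<Sum>k<q. corr g g k) + corr g g 0)"
proof -
  note [measurable] = g[THEN square_int_measurable]
  note seq = autocorr_even_odd[OF g]
  have cov: "expectation (\<lambda>\<omega>. g (X (c + int i) \<omega>) * g (X (c + int (i + k)) \<omega>)) = corr g g k" for i k
    using corr_shift[OF g g, of "c + int i" k] by (simp add: algebra_simps)
  have "expectation (\<lambda>\<omega>. (\<Sum>i<n. g (X (c + int i) \<omega>))\<^sup>2)
      = 2 * (\<Sum>m<n. \<Sum>k<Suc m. corr g g k) - real n * corr g g 0"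
    by (rule expectation_square_sum_stationary[OF _ square_int_integrable(1)[OF g] cov]) measurable
  also have "\<dots> \<le> 2 * (\<Sum>m<n. \<Sum>k<Suc m. corr g g k)"
    using abs_le_initial[of "corr g g", OF seq, of 0] by simp
  also have "(\<Sum>m<n. \<Sum>k<Suc m. corr g g k) \<le> (\<Sum>m<n. (\<Sum>k<q. corr g g k) + corr g g 0)"
    using n by (intro sum_mono partial_sum_le[of "corr g g", OF seq]) auto
  finally show ?thesis
    by simp
qed

end

section \<open>Martingale approximation and the central limit theorem\<close>

lemma power4_diff_le: "(a - b) ^ 4 \<le> 8 * (a ^ 4 + b ^ 4)" for a b :: real
proof -
  have sq: "(u - w)\<^sup>2 \<le> 2 * (u\<^sup>2 + w\<^sup>2)" "(u + w)\<^sup>2 \<le> 2 * (u\<^sup>2 + w\<^sup>2)" for u w :: real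
    using zero_le_power2[of "u + w"] zero_le_power2[of "u - w"] by (simp_all add: power2_sum power2_diff)
  have "(a - b) ^ 4 = ((a - b)\<^sup>2)\<^sup>2"
    by simp
  also have "\<dots> \<le> (2 * (a\<^sup>2 + b\<^sup>2))\<^sup>2"
    by (intro power_mono sq) simp
  also have "\<dots> = 4 * (a\<^sup>2 + b\<^sup>2)\<^sup>2"
    unfolding power_mult_distrib by simp
  also have "\<dots> \<le> 4 * (2 * ((a\<^sup>2)\<^sup>2 + (b\<^sup>2)\<^sup>2))"
    by (intro mult_left_mono sq) simp
  finally show ?thesis
    by simp
qed

lemma norm_iexp_diff_le: "norm (iexp x - iexp y) \<le> \<bar>x - y\<bar>"
proof -
  have "iexp x - iexp y = iexp y * (iexp (x - y) - 1)"
    by (simp add: algebra_simps exp_add[symmetric])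
  then have "norm (iexp x - iexp y) = norm (iexp (x - y) - 1)"
    by (simp only: norm_mult norm_exp_i_times mult_1_left)
  then show ?thesis
    using iexp_approx1[of "x - y" 0] by simp
qed

context stationary_reversible_chain
begin

definition increment :: "(real \<Rightarrow> real) \<Rightarrow> nat \<Rightarrow> 'a \<Rightarrow> real" where
  "increment g k \<omega> = g (X (int k + 1) \<omega>) - Q g (X (int k) \<omega>)"

text \<open>The constant is the mean of the square under the marginal law, so \<open>corr\<close> of
  this function with itself is the autocovariance of the squares.\<close>

definition centred_square :: "(real \<Rightarrow> real) \<Rightarrow> real \<Rightarrow> real" where
  "centred_square g x = (g x)\<^sup>2 - corr g g 0"

context
  fixes g :: "real \<Rightarrow> real"
  assumes g [measurable]: "g \<in> borel_measurable borel"
    and g4: "integrable M (\<lambda>\<omega>. g (X 0 \<omega>) ^ 4)"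
begin

lemma square_int_of_power4: "square_int g"
  using integrable_square_of_power4[OF _ g4] by (simp add: square_int_def)

lemmas square_int_Qg = square_int_transition[OF square_int_of_power4]

lemma measurable_Qg [measurable]: "Q g \<in> borel_measurable borel"
  by (rule square_int_measurable[OF square_int_Qg])

lemma measurable_increment [measurable]: "increment g k \<in> borel_measurable M"
  unfolding increment_def[abs_def] by measurable

lemma adapted_increment: "increment g k \<in> borel_measurable (past (int (Suc k)))"
proof -
  have "X (int k + 1) \<in> borel_measurable (past (int (Suc k)))" "X (int k) \<in> borel_measurable (past (int (Suc k)))"
    by (rule measurable_past; simp)+
  then show ?thesis
    unfolding increment_def[abs_def] by measurable
qed

lemma cond_exp_increment: "AE \<omega> in M. real_cond_exp M (past (int k)) (increment g k) \<omega> = 0"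
proof -
  interpret P: sigma_finite_subalgebra M "past (int k)"
    by (rule subalgebra_sigma_finite[OF subalgebra_past])
  have gi: "integrable M (\<lambda>\<omega>. g (X (int k + 1) \<omega>))" and hi: "integrable M (\<lambda>\<omega>. Q g (X (int k) \<omega>))"
    by (intro square_int_integrable square_int_of_power4 square_int_Qg)+
  have "X (int k) \<in> borel_measurable (past (int k))"
    by (rule measurable_past) simp
  then have "(\<lambda>\<omega>. Q g (X (int k) \<omega>)) \<in> borel_measurable (past (int k))"
    by measurable
  note meas = P.real_cond_exp_F_meas[OF hi this]
  show ?thesis
    unfolding increment_def[abs_def]
    using P.real_cond_exp_diff[OF gi hi] meas
      Q_characterization(2)[OF g square_int_integrable(2)[OF square_int_of_power4], of "int k"]
    by eventually_elim simp
qed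

lemma power4_shift:
  shows "integrable M (\<lambda>\<omega>. g (X i \<omega>) ^ 4)" "integrable M (\<lambda>\<omega>. Q g (X i \<omega>) ^ 4)"
    and "expectation (\<lambda>\<omega>. g (X i \<omega>) ^ 4) = expectation (\<lambda>\<omega>. g (X 0 \<omega>) ^ 4)"
    and "expectation (\<lambda>\<omega>. Q g (X i \<omega>) ^ 4) \<le> expectation (\<lambda>\<omega>. g (X 0 \<omega>) ^ 4)"
  using g4 transition_power_le[OF g g4] integrable_stationary[of "\<lambda>x. g x ^ 4" i]
    integrable_stationary[of "\<lambda>x. Q g x ^ 4" i] expectation_stationary[of "\<lambda>x. g x ^ 4" i]
    expectation_stationary[of "\<lambda>x. Q g x ^ 4" i] by simp_all

lemma square_shift:
  assumes "square_int u"
  shows "expectation (\<lambda>\<omega>. (u (X i \<omega>))\<^sup>2) = corr u u 0"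
  using corr_shift[OF assms assms, of i 0] by (simp add: power2_eq_square)

text \<open>16 is the 8 of \<open>power4_diff_le\<close> times two fourth moments, that of
  \<open>Q g\<close> being at most that of g.\<close>

lemma increment_power4:
  shows "integrable M (\<lambda>\<omega>. increment g k \<omega> ^ 4)"
    and "expectation (\<lambda>\<omega>. increment g k \<omega> ^ 4) \<le> 16 * expectation (\<lambda>\<omega>. g (X 0 \<omega>) ^ 4)"
proof -
  let ?b = "\<lambda>\<omega>. 8 * (g (X (int k + 1) \<omega>) ^ 4 + Q g (X (int k) \<omega>) ^ 4)"
  have b: "integrable M ?b"
    using power4_shift by simp
  show i: "integrable M (\<lambda>\<omega>. increment g k \<omega> ^ 4)"
    by (rule Bochner_Integration.integrable_bound[OF b])
      (use power4_diff_le in \<open>auto simp: increment_def intro!: AE_I2 order_trans[OF _ abs_ge_self]\<close>)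
  have "expectation (\<lambda>\<omega>. increment g k \<omega> ^ 4) \<le> expectation ?b"
    by (intro integral_mono i b) (simp only: increment_def power4_diff_le)
  also have "\<dots> \<le> 16 * expectation (\<lambda>\<omega>. g (X 0 \<omega>) ^ 4)"
    using power4_shift(1,2) power4_shift(3)[of "int k + 1"] power4_shift(4)[of "int k"] by simp
  finally show "expectation (\<lambda>\<omega>. increment g k \<omega> ^ 4) \<le> 16 * expectation (\<lambda>\<omega>. g (X 0 \<omega>) ^ 4)" .
qed

lemma increment_square:
  shows "integrable M (\<lambda>\<omega>. (increment g k \<omega>)\<^sup>2)"
    and "expectation (\<lambda>\<omega>. (increment g k \<omega>)\<^sup>2) \<le> 4 * corr g g 0"
proof -
  let ?b = "\<lambda>\<omega>. 2 * ((g (X (int k + 1) \<omega>))\<^sup>2 + (Q g (X (int k) \<omega>))\<^sup>2)"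
  show i: "integrable M (\<lambda>\<omega>. (increment g k \<omega>)\<^sup>2)"
    by (rule integrable_square_of_power4[OF measurable_increment increment_power4(1)])
  note sq = square_int_integrable(1)[OF square_int_of_power4, of "int k + 1"]
    square_int_integrable(1)[OF square_int_Qg, of "int k"]
  have "(u - w)\<^sup>2 \<le> 2 * (u\<^sup>2 + w\<^sup>2)" for u w :: real
    using zero_le_power2[of "u + w"] by (simp add: power2_sum power2_diff)
  then have "expectation (\<lambda>\<omega>. (increment g k \<omega>)\<^sup>2) \<le> expectation ?b"
    using sq by (intro integral_mono i) (simp_all only: increment_def, simp)
  also have "\<dots> = 2 * (corr g g 0 + corr (Q g) (Q g) 0)"
    using sq square_shift[OF square_int_of_power4] square_shift[OF square_int_Qg] by simp
  also have "\<dots> \<le> 4 * corr g g 0"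
    using autocorr_0_antimono[OF square_int_of_power4] by simp
  finally show "expectation (\<lambda>\<omega>. (increment g k \<omega>)\<^sup>2) \<le> 4 * corr g g 0" .
qed

text \<open>Cauchy-Schwarz for |d| and d^2; the 8 is the root of 4 times 16. Only the root of E g^4
  appears, so n such terms divided by n^(3/2) are small as soon as E g^4 / n is small and the second
  moment is bounded.\<close>

lemma increment_power3:
  "expectation (\<lambda>\<omega>. \<bar>increment g k \<omega>\<bar> ^ 3) \<le> 8 * sqrt (corr g g 0 * expectation (\<lambda>\<omega>. g (X 0 \<omega>) ^ 4))"
proof -
  let ?m = "expectation (\<lambda>\<omega>. g (X 0 \<omega>) ^ 4)"
  have "expectation (\<lambda>\<omega>. \<bar>increment g k \<omega>\<bar> ^ 3) = expectation (\<lambda>\<omega>. \<bar>increment g k \<omega> * (increment g k \<omega>)\<^sup>2\<bar>)"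
    by (intro Bochner_Integration.integral_cong refl) (simp add: abs_mult power2_eq_square power3_eq_cube)
  also have "\<dots> \<le> sqrt (expectation (\<lambda>\<omega>. (increment g k \<omega>)\<^sup>2) * expectation (\<lambda>\<omega>. ((increment g k \<omega>)\<^sup>2)\<^sup>2))"
    using increment_square(1)[of k] increment_power4(1)[of k]
    by (intro integral_abs_mult_le_sqrt) simp_all
  also have "\<dots> \<le> sqrt ((4 * corr g g 0) * (16 * ?m))"
    using increment_square(2)[of k] increment_power4(2)[of k]
    by (intro real_sqrt_le_mono mult_mono) (simp_all add: corr_def)
  also have "(4 * corr g g 0) * (16 * ?m) = 8\<^sup>2 * (corr g g 0 * ?m)"
    by simp
  also have "sqrt \<dots> = 8 * sqrt (corr g g 0 * ?m)"
    by (subst real_sqrt_mult) simp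
  finally show ?thesis .
qed

text \<open>The difference is (Q g)^2 - 2 g (Q g), small in mean when \<open>Q g\<close> has small
  norm and g has bounded norm.\<close>

lemma increment_square_diff:
  "integrable M (\<lambda>\<omega>. (increment g k \<omega>)\<^sup>2 - (g (X (int k + 1) \<omega>))\<^sup>2)"
  "expectation (\<lambda>\<omega>. \<bar>(increment g k \<omega>)\<^sup>2 - (g (X (int k + 1) \<omega>))\<^sup>2\<bar>)
    \<le> 2 * sqrt (corr g g 0 * corr (Q g) (Q g) 0) + corr (Q g) (Q g) 0"
proof -
  let ?u = "\<lambda>\<omega>. g (X (int k + 1) \<omega>)" and ?w = "\<lambda>\<omega>. Q g (X (int k) \<omega>)"
  note sq = square_int_integrable(1)[OF square_int_of_power4, of "int k + 1"]
    square_int_integrable(1)[OF square_int_Qg, of "int k"]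
  show i: "integrable M (\<lambda>\<omega>. (increment g k \<omega>)\<^sup>2 - (?u \<omega>)\<^sup>2)"
    using increment_square(1) sq(1) by simp
  have p: "integrable M (\<lambda>\<omega>. \<bar>?u \<omega> * ?w \<omega>\<bar>)"
    by (intro integrable_abs integrable_mult_of_squares sq) measurable
  have pw: "\<bar>(u - w)\<^sup>2 - u\<^sup>2\<bar> \<le> 2 * \<bar>u * w\<bar> + w\<^sup>2" for u w :: real
  proof -
    have "(u - w)\<^sup>2 - u\<^sup>2 = w\<^sup>2 - 2 * (u * w)"
      by (simp add: power2_diff)
    then show ?thesis
      using zero_le_power2[of w] abs_ge_self[of "u * w"] abs_ge_minus_self[of "u * w"] by linarith
  qed
  have "expectation (\<lambda>\<omega>. \<bar>(increment g k \<omega>)\<^sup>2 - (?u \<omega>)\<^sup>2\<bar>) \<le> expectation (\<lambda>\<omega>. 2 * \<bar>?u \<omega> * ?w \<omega>\<bar> + (?w \<omega>)\<^sup>2)"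
  proof (rule integral_mono[OF integrable_abs[OF i]])
    show "integrable M (\<lambda>\<omega>. 2 * \<bar>?u \<omega> * ?w \<omega>\<bar> + (?w \<omega>)\<^sup>2)"
      by (intro Bochner_Integration.integrable_add integrable_mult_right p sq)
  qed (simp only: increment_def pw)
  also have "\<dots> = 2 * expectation (\<lambda>\<omega>. \<bar>?u \<omega> * ?w \<omega>\<bar>) + corr (Q g) (Q g) 0"
    using p sq square_shift[OF square_int_Qg] by simp
  also have "expectation (\<lambda>\<omega>. \<bar>?u \<omega> * ?w \<omega>\<bar>) \<le> sqrt (corr g g 0 * corr (Q g) (Q g) 0)"
    using integral_abs_mult_le_sqrt[OF _ _ sq] square_shift[OF square_int_of_power4] square_shift[OF square_int_Qg]
    by simp
  finally show "expectation (\<lambda>\<omega>. \<bar>(increment g k \<omega>)\<^sup>2 - (?u \<omega>)\<^sup>2\<bar>)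
    \<le> 2 * sqrt (corr g g 0 * corr (Q g) (Q g) 0) + corr (Q g) (Q g) 0"
    by simp
qed

lemma square_int_centred_square: "square_int (centred_square g)"
proof -
  have "integrable M (\<lambda>\<omega>. ((g (X 0 \<omega>))\<^sup>2 - corr g g 0)\<^sup>2)"
    using g4 by (intro integrable_square_diff) simp_all
  then show ?thesis
    unfolding square_int_def centred_square_def[abs_def] by simp
qed

lemma measurable_centred_square [measurable]: "centred_square g \<in> borel_measurable borel"
  by (rule square_int_measurable[OF square_int_centred_square])

text \<open>The variance of g^2 plus its squared mean. Divided by n, this turns control of the
  variance of the square into the Lyapunov condition.\<close>

lemma power4_eq_corr:
  "expectation (\<lambda>\<omega>. g (X 0 \<omega>) ^ 4) = corr (centred_square g) (centred_square g) 0 + (corr g g 0)\<^sup>2"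
proof -
  note i = square_int_integrable(1)[OF square_int_of_power4, of 0]
  have "corr (centred_square g) (centred_square g) 0
      = expectation (\<lambda>\<omega>. g (X 0 \<omega>) ^ 4 - 2 * corr g g 0 * (g (X 0 \<omega>))\<^sup>2 + (corr g g 0)\<^sup>2)"
    unfolding corr_def[of "centred_square g"] centred_square_def
    by (intro Bochner_Integration.integral_cong refl) (simp add: algebra_simps power2_eq_square power4_eq_xxxx)
  also have "\<dots> = expectation (\<lambda>\<omega>. g (X 0 \<omega>) ^ 4) - 2 * corr g g 0 * expectation (\<lambda>\<omega>. (g (X 0 \<omega>))\<^sup>2) + (corr g g 0)\<^sup>2"
    using g4 i by (simp add: prob_space)
  also have "\<dots> = expectation (\<lambda>\<omega>. g (X 0 \<omega>) ^ 4) - (corr g g 0)\<^sup>2"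
    unfolding square_shift[OF square_int_of_power4] by (simp add: power2_eq_square)
  finally show ?thesis
    by simp
qed

text \<open>For fixed t and s the bound depends only on n, A, B and the second moment of g, and it
  vanishes when n grows, A and B tend to 0 and the second moment tends to s. Its first term stems
  from the remainder and the others from the martingale; \<open>m\<close> dominates E g^4 /
  n.\<close>

lemma char_normalized_sum_bound:
  fixes n :: nat and s t :: real
  assumes n: "n \<ge> 2" and s: "s \<ge> 0"
  defines "A \<equiv> corr g g 2 + (\<Sum>k=2..n. corr g g k)"
    and "B \<equiv> (1 / real n) * (corr (centred_square g) (centred_square g) 0
      + (\<Sum>u=0..n. corr (centred_square g) (centred_square g) u))"
    and "a \<equiv> exp (t\<^sup>2 * (s + 1) / 2)"
  defines "m \<equiv> B + (corr g g 0)\<^sup>2 / real n"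
  shows "norm ((CLINT \<omega>|M. iexp (t * ((1 / sqrt (real n)) * (\<Sum>k=1..n. g (X (int k) \<omega>)))))
      - complex_of_real (exp (- (t\<^sup>2 * s / 2))))
    \<le> \<bar>t\<bar> * sqrt (2 * A)
      + ((1 + a + a * t\<^sup>2 / 2) * (sqrt (2 * B) + \<bar>corr g g 0 - s\<bar> + 2 * sqrt (corr g g 0 * A) + A + sqrt (16 * m))
        + a * (\<bar>t\<bar> ^ 3 / 6 * (8 * sqrt (corr g g 0 * m)) + t ^ 4 / 8 * (16 * m)))"
proof -
  let ?c = "corr g g 0" and ?c2 = "corr (Q g) (Q g) 0" and ?m4 = "expectation (\<lambda>\<omega>. g (X 0 \<omega>) ^ 4)"
  let ?e = "corr (centred_square g) (centred_square g)"
  let ?r = "sqrt (real n)"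
  have r: "?r > 0" "?r * ?r = real n" "?r\<^sup>2 = real n"
    using n by simp_all
  have r4: "?r ^ 4 = (real n)\<^sup>2"
    using n by (simp add: power4_eq_square_square)
  have c_nonneg: "?c \<ge> 0"
    by (simp add: corr_def)
  note seq_e = autocorr_even_odd[OF square_int_centred_square]
  note seq_Q = autocorr_even_odd[OF square_int_Qg]
  have c2: "corr g g 2 = ?c2"
    using autocorr_Suc_Suc[OF square_int_of_power4, of 0] by (simp add: numeral_2_eq_2)
  \<comment> \<open>Lags 2 to n of g are lags 0 to n - 2 of \<open>Q g\<close>.\<close>
  have T: "(\<Sum>k=2..n. corr g g k) = (\<Sum>k<n - 1. corr (Q g) (Q g) k)"
  proof -
    have "(\<Sum>k=2..n. corr g g k) = (\<Sum>k\<in>{0 + 2..<(n - 1) + 2}. corr g g k)"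
      using n by (intro sum.cong) auto
    also have "\<dots> = (\<Sum>k\<in>{0..<n - 1}. corr g g (k + 2))"
      by (rule sum.shift_bounds_nat_ivl)
    finally show ?thesis
      using autocorr_Suc_Suc[OF square_int_of_power4] by (simp add: atLeast0LessThan numeral_2_eq_2)
  qed
  \<comment> \<open>This is the bracket of \<open>expectation_square_sum_le\<close> for
    \<open>Q g\<close> with q = n - 1; the separate lag 2 covariance supplies its additional lag 0
    term.\<close>
  have A_eq: "A = (\<Sum>k<n - 1. corr (Q g) (Q g) k) + ?c2"
    by (simp add: A_def T c2)
  have c2_le: "?c2 \<le> A" "?c2 \<ge> 0"
    unfolding A_eq using partial_sum_nonneg[of "corr (Q g) (Q g)", OF seq_Q] by (simp_all add: corr_def)
  have B_eq: "B = ((\<Sum>k<n + 1. ?e k) + ?e 0) / real n"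
    unfolding B_def by (simp add: atLeast0AtMost lessThan_Suc_atMost add.commute)
  have m: "?m4 / real n \<le> m"
  proof -
    \<comment> \<open>Besides this term, B contains a partial sum of autocovariances of the squares,
      which is nonnegative and may be discarded.\<close>
    have "?e 0 / real n \<le> B"
      unfolding B_eq using partial_sum_nonneg[of ?e, OF seq_e, of "n + 1"]
      by (intro divide_right_mono, linarith, simp)
    then show ?thesis
      unfolding m_def power4_eq_corr by (simp add: add_divide_distrib)
  qed
  have m4_nonneg: "?m4 \<ge> 0"
    by simp
  have m_nonneg: "m \<ge> 0"
    using m m4_nonneg n by (meson divide_nonneg_nonneg of_nat_0_le_iff order_trans)
  define D where "D k \<omega> = increment g k \<omega> / ?r" for k \<omega>
  have D4: "integrable M (\<lambda>\<omega>. D k \<omega> ^ 4)" for k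
    using increment_power4(1)[of k] by (simp add: D_def power_divide)
  have ED4: "(\<Sum>k<n. expectation (\<lambda>\<omega>. D k \<omega> ^ 4)) \<le> 16 * m"
  proof -
    have "(\<Sum>k<n. expectation (\<lambda>\<omega>. D k \<omega> ^ 4)) = (\<Sum>k<n. expectation (\<lambda>\<omega>. increment g k \<omega> ^ 4)) / (real n)\<^sup>2"
      by (simp add: D_def power_divide r4 sum_divide_distrib)
    also have "\<dots> \<le> (\<Sum>k<n. 16 * ?m4) / (real n)\<^sup>2"
      by (intro divide_right_mono sum_mono increment_power4) simp
    also have "\<dots> = 16 * (?m4 / real n)"
      using n by (simp add: power2_eq_square)
    finally show ?thesis
      using m by simp
  qed
  have ED3: "(\<Sum>k<n. expectation (\<lambda>\<omega>. \<bar>D k \<omega>\<bar> ^ 3)) \<le> 8 * sqrt (?c * m)"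
  proof -
    have "(\<Sum>k<n. expectation (\<lambda>\<omega>. \<bar>D k \<omega>\<bar> ^ 3)) = (\<Sum>k<n. expectation (\<lambda>\<omega>. \<bar>increment g k \<omega>\<bar> ^ 3)) / ?r ^ 3"
      using r(1) by (simp add: D_def power_divide abs_divide sum_divide_distrib)
    also have "\<dots> \<le> (\<Sum>k<n. 8 * sqrt (?c * ?m4)) / ?r ^ 3"
      using r(1) by (intro divide_right_mono sum_mono increment_power3) simp
    also have "\<dots> = 8 * (sqrt (?c * ?m4) * (real n / ?r ^ 3))"
      by simp
    also have "real n / ?r ^ 3 = 1 / ?r"
      using r(1) by (subst r(2)[symmetric]) (simp add: power3_eq_cube)
    also have "sqrt (?c * ?m4) * (1 / ?r) = sqrt (?c * (?m4 / real n))"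
      by (simp add: real_sqrt_divide[symmetric])
    also have "8 * \<dots> \<le> 8 * sqrt (?c * m)"
      using m c_nonneg by (intro mult_left_mono real_sqrt_le_mono) simp_all
    finally show ?thesis
      by simp
  qed
  have ED2: "expectation (\<lambda>\<omega>. \<bar>(\<Sum>k<n. (D k \<omega>)\<^sup>2) - s\<bar>)
      \<le> sqrt (2 * B) + \<bar>?c - s\<bar> + 2 * sqrt (?c * A) + A"
  proof -
    let ?d = "\<lambda>k \<omega>. (increment g k \<omega>)\<^sup>2 - (g (X (int k + 1) \<omega>))\<^sup>2"
    \<comment> \<open>Increment k carries g at time k + 1, so the squares start at time 1.\<close>
    let ?S = "\<lambda>\<omega>. \<Sum>i<n. centred_square g (X (1 + int i) \<omega>)"
    have meas_S: "?S \<in> borel_measurable M"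
      by measurable
    have S2: "integrable M (\<lambda>\<omega>. (?S \<omega>)\<^sup>2)"
      by (intro integrable_square_sum square_int_integrable(1)[OF square_int_centred_square]) measurable
    have S1: "integrable M ?S"
      by (rule integrable_of_square[OF meas_S S2])
    \<comment> \<open>Three sources of error: the fluctuation of the squares of g about their mean,
      that mean against s, and the replacement of g by the increments.\<close>
    have dec: "(\<Sum>k<n. (D k \<omega>)\<^sup>2) - s = ?S \<omega> / real n + (?c - s) + (\<Sum>k<n. ?d k \<omega>) / real n" for \<omega>
    proof -
      have "(\<Sum>k<n. (D k \<omega>)\<^sup>2) = (\<Sum>k<n. (increment g k \<omega>)\<^sup>2) / real n"
        by (simp add: D_def power_divide sum_divide_distrib)
      moreover have "?S \<omega> = (\<Sum>k<n. (g (X (int k + 1) \<omega>))\<^sup>2) - real n * ?c"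
        by (simp add: centred_square_def sum_subtractf add.commute)
      ultimately show ?thesis
        using n by (simp add: sum_subtractf diff_divide_distrib)
    qed
    have d_abs: "\<bar>\<Sum>k<n. ?d k \<omega>\<bar> \<le> (\<Sum>k<n. \<bar>?d k \<omega>\<bar>)" for \<omega>
      by (rule sum_abs)
    let ?b = "\<lambda>\<omega>. \<bar>?S \<omega>\<bar> / real n + \<bar>?c - s\<bar> + (\<Sum>k<n. \<bar>?d k \<omega>\<bar>) / real n"
    have b: "integrable M (\<lambda>\<omega>. \<bar>?S \<omega>\<bar> / real n)" "integrable M (\<lambda>\<omega>. (\<Sum>k<n. \<bar>?d k \<omega>\<bar>) / real n)"
      by (intro integrable_divide integrable_abs S1)
        (intro integrable_divide Bochner_Integration.integrable_sum integrable_abs increment_square_diff(1))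
    have "expectation (\<lambda>\<omega>. \<bar>(\<Sum>k<n. (D k \<omega>)\<^sup>2) - s\<bar>) \<le> expectation ?b"
    proof (rule integral_mono)
      show "integrable M (\<lambda>\<omega>. \<bar>(\<Sum>k<n. (D k \<omega>)\<^sup>2) - s\<bar>)"
        unfolding dec
        by (intro integrable_abs Bochner_Integration.integrable_add integrable_divide
            Bochner_Integration.integrable_sum integrable_const increment_square_diff(1)
            square_int_integrable(2)[OF square_int_centred_square])
      show "integrable M ?b"
        by (intro Bochner_Integration.integrable_add b integrable_const)
      fix \<omega>
      have "\<bar>(\<Sum>k<n. ?d k \<omega>) / real n\<bar> \<le> (\<Sum>k<n. \<bar>?d k \<omega>\<bar>) / real n"
        using d_abs[of \<omega>] by (simp add: abs_divide divide_right_mono)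
      moreover have "\<bar>?S \<omega> / real n\<bar> = \<bar>?S \<omega>\<bar> / real n"
        by (simp add: abs_divide)
      ultimately show "\<bar>(\<Sum>k<n. (D k \<omega>)\<^sup>2) - s\<bar> \<le> ?b \<omega>"
        unfolding dec by linarith
    qed
    also have "\<dots> = expectation (\<lambda>\<omega>. \<bar>?S \<omega>\<bar>) / real n + \<bar>?c - s\<bar> + (\<Sum>k<n. expectation (\<lambda>\<omega>. \<bar>?d k \<omega>\<bar>)) / real n"
      using b increment_square_diff(1) by (simp add: prob_space)
    also have "expectation (\<lambda>\<omega>. \<bar>?S \<omega>\<bar>) / real n \<le> sqrt (2 * B)"
    proof -
      have "expectation (\<lambda>\<omega>. \<bar>?S \<omega>\<bar>) / real n \<le> sqrt (expectation (\<lambda>\<omega>. (?S \<omega>)\<^sup>2)) / real n"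
        by (intro divide_right_mono expectation_abs_le_sqrt meas_S S2) simp
      \<comment> \<open>B sums the lags 0 to n, hence q = n + 1.\<close>
      also have "\<dots> \<le> sqrt (2 * real n * ((\<Sum>k<n + 1. ?e k) + ?e 0)) / real n"
        by (intro divide_right_mono real_sqrt_le_mono expectation_square_sum_le[OF square_int_centred_square]) simp_all
      also have "\<dots> = sqrt (2 * real n * ((\<Sum>k<n + 1. ?e k) + ?e 0) / (real n)\<^sup>2)"
        by (simp add: real_sqrt_divide)
      also have "2 * real n * ((\<Sum>k<n + 1. ?e k) + ?e 0) / (real n)\<^sup>2 = 2 * B"
        unfolding B_eq using n by (simp add: power2_eq_square)
      finally show ?thesis .
    qed
    also have "(\<Sum>k<n. expectation (\<lambda>\<omega>. \<bar>?d k \<omega>\<bar>)) / real n \<le> (\<Sum>k<n. 2 * sqrt (?c * ?c2) + ?c2) / real n"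
      by (intro divide_right_mono sum_mono increment_square_diff(2)) simp
    also have "\<dots> = 2 * sqrt (?c * ?c2) + ?c2"
      using n by simp
    also have "\<dots> \<le> 2 * sqrt (?c * A) + A"
      using c2_le c_nonneg by (intro add_mono mult_left_mono real_sqrt_le_mono) simp_all
    finally show ?thesis
      by simp
  qed
  let ?target = "complex_of_real (exp (- (t\<^sup>2 * s / 2)))"
  have mart: "norm ((CLINT \<omega>|M. iexp (t * (\<Sum>k<n. D k \<omega>))) - ?target)
    \<le> (1 + a + a * t\<^sup>2 / 2) * (expectation (\<lambda>\<omega>. \<bar>(\<Sum>k<n. (D k \<omega>)\<^sup>2) - s\<bar>)
        + sqrt (\<Sum>k<n. expectation (\<lambda>\<omega>. D k \<omega> ^ 4)))
      + a * (\<bar>t\<bar> ^ 3 / 6 * (\<Sum>k<n. expectation (\<lambda>\<omega>. \<bar>D k \<omega>\<bar> ^ 3))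
        + t ^ 4 / 8 * (\<Sum>k<n. expectation (\<lambda>\<omega>. D k \<omega> ^ 4)))"
    unfolding a_def
  proof (rule martingale_char_bound[of "\<lambda>k. past (int k)", OF subalgebra_past _ _ D4 _ s])
    show "sets (past (int k)) \<subseteq> sets (past (int (Suc k)))" for k
      by (rule sets_generated_algebra_mono) auto
    show "D k \<in> borel_measurable (past (int (Suc k)))" for k
      using adapted_increment[of k] unfolding D_def[abs_def] by measurable
    show "AE \<omega> in M. real_cond_exp M (past (int k)) (D k) \<omega> = 0" for k
    proof -
      interpret P: sigma_finite_subalgebra M "past (int k)"
        by (rule subalgebra_sigma_finite[OF subalgebra_past])
      have "integrable M (increment g k)"
        by (rule integrable_of_square[OF measurable_increment increment_square(1)])
      from P.real_cond_exp_cdiv[OF this, of ?r] cond_exp_increment[of k] show ?thesis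
        unfolding D_def[abs_def] by eventually_elim simp
    qed
  qed
  also have "\<dots> \<le> (1 + a + a * t\<^sup>2 / 2) * ((sqrt (2 * B) + \<bar>?c - s\<bar> + 2 * sqrt (?c * A) + A) + sqrt (16 * m))
        + a * (\<bar>t\<bar> ^ 3 / 6 * (8 * sqrt (?c * m)) + t ^ 4 / 8 * (16 * m))"
  proof -
    have "a \<ge> 0"
      by (simp add: a_def)
    then show ?thesis
      by (intro add_mono mult_left_mono ED2 ED3 ED4 real_sqrt_le_mono) (simp_all add: add_nonneg_nonneg)
  qed
  finally have mart': "norm ((CLINT \<omega>|M. iexp (t * (\<Sum>k<n. D k \<omega>))) - ?target) \<le> \<dots>" .
  \<comment> \<open>The remainder runs over times 0 to n - 1; the explicit 0 matches the starting
    time c in \<open>expectation_square_sum_le\<close>.\<close>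
  let ?R = "\<lambda>\<omega>. \<Sum>i<n. Q g (X (0 + int i) \<omega>)"
  let ?S = "\<lambda>\<omega>. (1 / ?r) * (\<Sum>k=1..n. g (X (int k) \<omega>))"
  have S_eq: "?S \<omega> = (\<Sum>k<n. D k \<omega>) + ?R \<omega> / ?r" for \<omega>
  proof -
    have "(\<Sum>k=1..n. g (X (int k) \<omega>)) = (\<Sum>k<n. g (X (int k + 1) \<omega>))"
      by (simp add: sum.atLeast1_atMost_eq add.commute)
    also have "\<dots> = (\<Sum>k<n. increment g k \<omega>) + ?R \<omega>"
      by (simp add: increment_def sum_subtractf)
    finally show ?thesis
      by (simp add: D_def sum_divide_distrib[symmetric] add_divide_distrib)
  qed
  have R2: "integrable M (\<lambda>\<omega>. (?R \<omega>)\<^sup>2)"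
    by (intro integrable_square_sum square_int_integrable(1)[OF square_int_Qg]) measurable
  have R_meas: "?R \<in> borel_measurable M"
    by measurable
  have R1: "integrable M ?R"
    by (rule integrable_of_square[OF R_meas R2])
  have R_le: "expectation (\<lambda>\<omega>. \<bar>?R \<omega>\<bar>) / ?r \<le> sqrt (2 * A)"
  proof -
    have "expectation (\<lambda>\<omega>. \<bar>?R \<omega>\<bar>) / ?r \<le> sqrt (expectation (\<lambda>\<omega>. (?R \<omega>)\<^sup>2)) / ?r"
      using r(1) by (intro divide_right_mono expectation_abs_le_sqrt R_meas R2) simp
    also have "\<dots> \<le> sqrt (2 * real n * ((\<Sum>k<n - 1. corr (Q g) (Q g) k) + ?c2)) / ?r"
      using r(1) n by (intro divide_right_mono real_sqrt_le_mono expectation_square_sum_le[OF square_int_Qg]) simp_all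
    also have "\<dots> = sqrt (2 * real n * A / real n)"
      unfolding A_eq by (rule real_sqrt_divide[symmetric])
    also have "2 * real n * A / real n = 2 * A"
      using n by simp
    finally show ?thesis .
  qed
  have [measurable]: "D k \<in> borel_measurable M" for k
    unfolding D_def[abs_def] by measurable
  have i1: "integrable M (\<lambda>\<omega>. iexp (t * ?S \<omega>))" and i2: "integrable M (\<lambda>\<omega>. iexp (t * (\<Sum>k<n. D k \<omega>)))"
    by (rule integrable_const_bound[of _ 1]; simp flip: of_real_mult)+
  have "norm ((CLINT \<omega>|M. iexp (t * ?S \<omega>)) - (CLINT \<omega>|M. iexp (t * (\<Sum>k<n. D k \<omega>))))
      = norm (CLINT \<omega>|M. iexp (t * ?S \<omega>) - iexp (t * (\<Sum>k<n. D k \<omega>)))"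
    by (simp only: Bochner_Integration.integral_diff[OF i1 i2])
  also have "\<dots> \<le> expectation (\<lambda>\<omega>. norm (iexp (t * ?S \<omega>) - iexp (t * (\<Sum>k<n. D k \<omega>))))"
    by (rule integral_norm_bound)
  also have "\<dots> \<le> expectation (\<lambda>\<omega>. \<bar>t\<bar> * (\<bar>?R \<omega>\<bar> / ?r))"
  proof (rule integral_mono)
    show "integrable M (\<lambda>\<omega>. norm (iexp (t * ?S \<omega>) - iexp (t * (\<Sum>k<n. D k \<omega>))))"
      by (intro integrable_norm Bochner_Integration.integrable_diff i1 i2)
    show "integrable M (\<lambda>\<omega>. \<bar>t\<bar> * (\<bar>?R \<omega>\<bar> / ?r))"
      by (intro integrable_mult_right integrable_divide integrable_abs R1)
    fix \<omega>
    have "t * ?S \<omega> - t * (\<Sum>k<n. D k \<omega>) = t * (?R \<omega> / ?r)"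
      unfolding S_eq by (simp add: algebra_simps)
    then have "\<bar>t * ?S \<omega> - t * (\<Sum>k<n. D k \<omega>)\<bar> = \<bar>t\<bar> * (\<bar>?R \<omega>\<bar> / ?r)"
      using r(1) by (simp only: abs_mult abs_divide abs_of_pos)
    then show "norm (iexp (t * ?S \<omega>) - iexp (t * (\<Sum>k<n. D k \<omega>))) \<le> \<bar>t\<bar> * (\<bar>?R \<omega>\<bar> / ?r)"
      using norm_iexp_diff_le by metis
  qed
  also have "\<dots> = \<bar>t\<bar> * (expectation (\<lambda>\<omega>. \<bar>?R \<omega>\<bar>) / ?r)"
    by simp
  also have "\<dots> \<le> \<bar>t\<bar> * sqrt (2 * A)"
    by (intro mult_left_mono R_le) simp
  finally have rem: "norm ((CLINT \<omega>|M. iexp (t * ?S \<omega>)) - (CLINT \<omega>|M. iexp (t * (\<Sum>k<n. D k \<omega>)))) \<le> \<bar>t\<bar> * sqrt (2 * A)" .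
  have "norm ((CLINT \<omega>|M. iexp (t * ?S \<omega>)) - ?target)
      \<le> norm ((CLINT \<omega>|M. iexp (t * ?S \<omega>)) - (CLINT \<omega>|M. iexp (t * (\<Sum>k<n. D k \<omega>))))
        + norm ((CLINT \<omega>|M. iexp (t * (\<Sum>k<n. D k \<omega>))) - ?target)"
    using norm_triangle_ineq[of "(CLINT \<omega>|M. iexp (t * ?S \<omega>)) - (CLINT \<omega>|M. iexp (t * (\<Sum>k<n. D k \<omega>)))"
        "(CLINT \<omega>|M. iexp (t * (\<Sum>k<n. D k \<omega>))) - ?target"] by (simp only: diff_add_cancel add_diff_eq)
  then show ?thesis
    by (rule order_trans[OF _ add_mono[OF rem mart']])
qed

end

end

section \<open>Characteristic functions and the passage to the limit\<close>

lemma char_normal_law: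
  assumes "v \<ge> 0"
  shows "real_distribution (normal_law 0 v)"
    and "char (normal_law 0 v) t = complex_of_real (exp (- (t\<^sup>2 * v / 2)))"
proof -
  have "real_distribution (normal_law 0 v) \<and> char (normal_law 0 v) t = complex_of_real (exp (- (t\<^sup>2 * v / 2)))"
  proof (cases "v = 0")
    case True
    \<comment> \<open>The point mass at 0 has characteristic function 1, which is the general
      formula at v = 0; thus \<sigma> = 0 is covered by the same limit argument.\<close>
    interpret R: prob_space "return borel (0::real)"
      by (rule prob_space_return) simp
    show ?thesis
      using True R.prob_space_axioms
      by (auto simp: normal_law_def char_def integral_return real_distribution_def real_distribution_axioms_def)
  next
    case False
    then have v: "sqrt v > 0"
      using assms by simp
    interpret N: real_distribution std_normal_distribution
      by (rule real_dist_normal_dist)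
    \<comment> \<open>A centred normal law is the standard one scaled by its standard deviation, so
      its characteristic function is the standard one at a rescaled argument.\<close>
    have eq: "normal_law 0 v = distr std_normal_distribution borel (\<lambda>x. sqrt v * x)"
    proof -
      have "distributed std_normal_distribution lborel (\<lambda>x. x) std_normal_density"
        by (auto simp: distributed_def distr_id2)
      then have "distributed std_normal_distribution lborel (\<lambda>x. 0 + sqrt v * x) (normal_density (0 + sqrt v * 0) (\<bar>sqrt v\<bar> * 1))"
        using v by (intro N.normal_density_affine) auto
      then have "distr std_normal_distribution lborel (\<lambda>x. sqrt v * x) = density lborel (normal_density 0 (sqrt v))"
        using v by (simp add: distributed_def)
      then show ?thesis
        using False by (simp add: normal_law_def cong: distr_cong)
    qed
    show ?thesis
    proof
      show "real_distribution (normal_law 0 v)"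
        unfolding eq by (rule N.real_distribution_distr) simp
      have "char (normal_law 0 v) t = char std_normal_distribution (t * sqrt v)"
        unfolding eq char_def by (subst integral_distr) (simp_all add: mult.assoc)
      then show "char (normal_law 0 v) t = complex_of_real (exp (- (t\<^sup>2 * v / 2)))"
        using assms by (simp add: char_std_normal_distribution power_mult_distrib)
    qed
  qed
  then show "real_distribution (normal_law 0 v)"
    and "char (normal_law 0 v) t = complex_of_real (exp (- (t\<^sup>2 * v / 2)))"
    by auto
qed

theorem theorem5:
  fixes M :: "'a measure"
    and X :: "int \<Rightarrow> 'a \<Rightarrow> real"
    and f :: "nat \<Rightarrow> real \<Rightarrow> real"
    and \<sigma> :: real
  assumes "prob_space M"
    and "markov_chain M X" and "strictly_stationary M X" and "reversible M X"
    and "\<And>n. n \<ge> 1 \<Longrightarrow> f n \<in> borel_measurable borel"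
    and "\<And>n k. n \<ge> 1 \<Longrightarrow> integrable M (\<lambda>\<omega>. (f n (X k \<omega>)) ^ 4)"
    and "\<And>n k. n \<ge> 1 \<Longrightarrow> prob_space.expectation M (\<lambda>\<omega>. f n (X k \<omega>)) = 0"
    and "(\<lambda>n. prob_space.expectation M (\<lambda>\<omega>. (f n (X 0 \<omega>))\<^sup>2)) \<longlonglongrightarrow> \<sigma>\<^sup>2"
    and "(\<lambda>n. covariance M (\<lambda>\<omega>. f n (X 0 \<omega>)) (\<lambda>\<omega>. f n (X 2 \<omega>))
             + (\<Sum>k=2..n. covariance M (\<lambda>\<omega>. f n (X 0 \<omega>)) (\<lambda>\<omega>. f n (X (int k) \<omega>))))
           \<longlonglongrightarrow> 0"
    and "(\<lambda>n. (1 / real n) *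
            (prob_space.variance M (\<lambda>\<omega>. (f n (X 0 \<omega>))\<^sup>2)
             + (\<Sum>u=0..n. covariance M (\<lambda>\<omega>. (f n (X 0 \<omega>))\<^sup>2) (\<lambda>\<omega>. (f n (X (int u) \<omega>))\<^sup>2))))
           \<longlonglongrightarrow> 0"
  shows "weak_conv_m
           (\<lambda>n. distr M borel (\<lambda>\<omega>. (1 / sqrt (real n)) * (\<Sum>k=1..n. f n (X (int k) \<omega>))))
           (normal_law 0 (\<sigma>\<^sup>2))"
proof -
  interpret stationary_reversible_chain M X
    using assms(1-4) by (simp add: stationary_reversible_chain_def stationary_reversible_chain_axioms_def)
  note f_meas = assms(5) and f4 = assms(6)
  let ?g2 = "\<lambda>n. centred_square (f n)"
  let ?S = "\<lambda>n \<omega>. (1 / sqrt (real n)) * (\<Sum>k=1..n. f n (X (int k) \<omega>))"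
  define c where "c n = corr (f n) (f n) 0" for n
  define A where "A n = corr (f n) (f n) 2 + (\<Sum>k=2..n. corr (f n) (f n) k)" for n
  define B where "B n = (1 / real n) * (corr (?g2 n) (?g2 n) 0 + (\<Sum>u=0..n. corr (?g2 n) (?g2 n) u))" for n
  define m where "m n = B n + (c n)\<^sup>2 / real n" for n
  have c_eq: "c n = expectation (\<lambda>\<omega>. (f n (X i \<omega>))\<^sup>2)" if "n \<ge> 1" for n i
    using expectation_stationary[of "\<lambda>x. (f n x)\<^sup>2" i] f_meas[OF that]
    by (simp add: c_def corr_def power2_eq_square)
  \<comment> \<open>The means vanish at all times, so the centring in \<open>covariance\<close>
    subtracts 0 and \<open>corr\<close> is the covariance.\<close>
  have A_eq: "A n = covariance M (\<lambda>\<omega>. f n (X 0 \<omega>)) (\<lambda>\<omega>. f n (X 2 \<omega>))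
      + (\<Sum>k=2..n. covariance M (\<lambda>\<omega>. f n (X 0 \<omega>)) (\<lambda>\<omega>. f n (X (int k) \<omega>)))" if "n \<ge> 1" for n
    using assms(7)[OF that] by (simp add: A_def covariance_def corr_def)
  \<comment> \<open>\<open>covariance\<close> centres each square by the mean at its own time; by
    stationarity all these means are \<open>c n\<close>.\<close>
  have g2_eq: "centred_square (f n) (X i \<omega>) = (f n (X i \<omega>))\<^sup>2 - expectation (\<lambda>\<omega>. (f n (X i \<omega>))\<^sup>2)"
    if "n \<ge> 1" for n i \<omega>
    using c_eq[OF that, of i] centred_square_def[of "f n" "X i \<omega>"] by (simp add: c_def)
  have B_eq: "B n = (1 / real n) * (variance (\<lambda>\<omega>. (f n (X 0 \<omega>))\<^sup>2)
      + (\<Sum>u=0..n. covariance M (\<lambda>\<omega>. (f n (X 0 \<omega>))\<^sup>2) (\<lambda>\<omega>. (f n (X (int u) \<omega>))\<^sup>2)))" if "n \<ge> 1" for n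
    using g2_eq[OF that] by (simp add: B_def covariance_def corr_def power2_eq_square)
  \<comment> \<open>\<open>f 0\<close> is unconstrained, so the identities above hold from n = 1 on,
    and the limits are transferred along large n.\<close>
  have large: "\<forall>\<^sub>F n in sequentially. n \<ge> (1::nat)" "\<forall>\<^sub>F n in sequentially. n \<ge> (2::nat)"
    by (rule eventually_ge_at_top)+
  have c_lim: "c \<longlonglongrightarrow> \<sigma>\<^sup>2"
    by (rule Lim_transform_eventually[OF assms(8) eventually_mono[OF large(1)]]) (rule c_eq[symmetric])
  have A_lim: "A \<longlonglongrightarrow> 0"
    by (rule Lim_transform_eventually[OF assms(9) eventually_mono[OF large(1)]]) (rule A_eq[symmetric])
  have B_lim: "B \<longlonglongrightarrow> 0"
    by (rule Lim_transform_eventually[OF assms(10) eventually_mono[OF large(1)]]) (rule B_eq[symmetric])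
  have m_lim: "m \<longlonglongrightarrow> 0"
  proof -
    have "(\<lambda>n. B n + (c n)\<^sup>2 * (1 / real n)) \<longlonglongrightarrow> 0 + (\<sigma>\<^sup>2)\<^sup>2 * 0"
      by (intro tendsto_intros B_lim c_lim lim_1_over_n)
    then show ?thesis
      by (simp add: m_def[abs_def])
  qed
  \<comment> \<open>For n = 0 the sum is empty, so measurability extends to the index at which
    \<open>f n\<close> is unconstrained.\<close>
  have meas_S: "?S n \<in> borel_measurable M" for n
    using f_meas[of n] by (cases "n = 0") (simp_all add: Suc_leI)
  have conv: "(\<lambda>n. char (distr M borel (?S n)) t) \<longlonglongrightarrow> char (normal_law 0 (\<sigma>\<^sup>2)) t" for t
  proof -
    define a where "a = exp (t\<^sup>2 * (\<sigma>\<^sup>2 + 1) / 2)"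
    let ?b = "\<lambda>n. \<bar>t\<bar> * sqrt (2 * A n)
      + ((1 + a + a * t\<^sup>2 / 2) * (sqrt (2 * B n) + \<bar>c n - \<sigma>\<^sup>2\<bar> + 2 * sqrt (c n * A n) + A n + sqrt (16 * m n))
        + a * (\<bar>t\<bar> ^ 3 / 6 * (8 * sqrt (c n * m n)) + t ^ 4 / 8 * (16 * m n)))"
    have bound: "norm (char (distr M borel (?S n)) t - char (normal_law 0 (\<sigma>\<^sup>2)) t) \<le> ?b n" if n: "n \<ge> 2" for n
    proof -
      have n1: "n \<ge> 1"
        using n by simp
      have "char (distr M borel (?S n)) t = (CLINT \<omega>|M. iexp (t * ?S n \<omega>))"
        unfolding char_def by (rule integral_distr[OF meas_S]) measurable
      then show ?thesis
        using char_normalized_sum_bound[OF f_meas[OF n1] f4[OF n1] n, of "\<sigma>\<^sup>2" t]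
        by (simp only: char_normal_law(2) zero_le_power2 a_def A_def B_def c_def m_def simp_thms)
    qed
    \<comment> \<open>As \<open>c n\<close> has a finite limit, its products with \<open>A n\<close>
      and \<open>m n\<close> tend to 0, and every term of the bound is continuous there.\<close>
    have "?b \<longlonglongrightarrow> \<bar>t\<bar> * sqrt (2 * 0)
      + ((1 + a + a * t\<^sup>2 / 2) * (sqrt (2 * 0) + \<bar>\<sigma>\<^sup>2 - \<sigma>\<^sup>2\<bar> + 2 * sqrt (\<sigma>\<^sup>2 * 0) + 0 + sqrt (16 * 0))
        + a * (\<bar>t\<bar> ^ 3 / 6 * (8 * sqrt (\<sigma>\<^sup>2 * 0)) + t ^ 4 / 8 * (16 * 0)))"
      by (intro tendsto_intros A_lim B_lim c_lim m_lim)
    then have "?b \<longlonglongrightarrow> 0"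
      by simp
    then have "(\<lambda>n. char (distr M borel (?S n)) t - char (normal_law 0 (\<sigma>\<^sup>2)) t) \<longlonglongrightarrow> 0"
      by (rule Lim_null_comparison[rotated]) (rule eventually_mono[OF large(2) bound])
    then show ?thesis
      by (simp add: LIM_zero_iff)
  qed
  show ?thesis
  proof (rule levy_continuity)
    show "real_distribution (distr M borel (?S n))" for n
      by (rule real_distribution_distr[OF meas_S])
    show "real_distribution (normal_law 0 (\<sigma>\<^sup>2))"
      by (rule char_normal_law(1)) simp
    show "(\<lambda>n. char (distr M borel (?S n)) t) \<longlonglongrightarrow> char (normal_law 0 (\<sigma>\<^sup>2)) t" for t
      by (rule conv)
  qed
qed

end
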